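(* There exist an absolute constant $C$ and a polynomial-time randomized algorithm that, given a metric space $(X,d)$ on $n$ points and a parameter $\Delta>0$, returns a random partition $\mathcal{P}$ of $X$ such that the diameter of every set $P\in\mathcal{P}$ is at most $\Delta$ and, for every real $q\ge 1$ and every weighted graph $G=(X,E,w)$ with nonnegative weights, $$\mathbb{E}\big[\|\mathrm{cut}(\mathcal{P},E)\|_q\big]\le C\, n^{\frac{q-1}{2q}}\log^{\frac{q+1}{2q}} n\cdot\Big[\Big(\sum_{u\in X}\sum_{v:(u,v)\in E} w_{uv}^q\frac{d(u,v)}{\Delta}\Big)^{1/q}+\Big(\sum_{u\in X}\Big(\sum_{v:(u,v)\in E} w_{uv}\frac{d(u,v)}{\Delta}\Big)^q\Big)^{1/q}\Big].$$
   Context: For a partition $\mathcal{P}$ of $X$ and a set $E$ of weighted edges (unordered pairs) on $X$ with weights $w_{uv}\ge 0$, the cut vector $\mathrm{cut}(\mathcal{P},E)\in\mathbb{R}^X$ has coordinates $\mathrm{cut}_u(\mathcal{P},E)=\sum_{v:(u,v)\in E} w_{uv}\mathbf{1}(u\text{ and }v\text{ lie in different parts of }\mathcal{P})$. The algorithm receives only $(X,d)$ and $\Delta$ (not $q$ or $G$). $\|x\|_q=(\sum_u x_u^q)^{1/q}$. *)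

theory Defs
  imports
    "HOL-Probability.Probability"
    "HOL-Computational_Algebra.Polynomial"
begin

section \<open>Randomized real-RAM programs\<close>

text \<open>
  Distances are arbitrary real numbers, so the machine model is the unit-cost real RAM: it has
  natural-number memory (counters, addresses, labels) and real-number memory, both organised as
  finitely many named arrays with computed indices. The points of the metric space are
  \<open>0, \<dots>, n - 1\<close>. The input \<open>n\<close>, the distances and \<open>\<Delta>\<close> is read-only.

  The instruction set is restricted so that unit cost is an honest measure of time. There is no
  rounding of reals to integers, and the only arithmetic on naturals is addition and truncated
  subtraction, so that after \<open>t\<close> steps all naturals (in particular all addresses) have
  \<open>O(t + log n)\<close> bits. The only constants in a program are natural numbers, so that no
  non-computable real can be built into it.
\<close>

datatype nexp =
    NConst nat
  | NSize
  | NGet nat nexp  \<comment> \<open>array name, index\<close>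
  | NAdd nexp nexp
  | NSub nexp nexp

datatype rexp =
    RNat nexp
  | RDelta
  | RDist nexp nexp
  | RGet nat nexp
  | RAdd rexp rexp
  | RSub rexp rexp
  | RMul rexp rexp
  | RDiv rexp rexp

datatype bexp =
    NLess nexp nexp
  | RLess rexp rexp
  | BNot bexp
  | BAnd bexp bexp

datatype com =
    Skip
  | NSet nat nexp nexp  \<comment> \<open>array name, index, new value\<close>
  | RSet nat nexp rexp
  | Sample nat nexp     \<comment> \<open>store a fresh uniform sample from \<open>[0,1]\<close>\<close>
  | Seq com com
  | Cond bexp com com
  | While bexp com

record state =
  nats :: "nat \<Rightarrow> nat \<Rightarrow> nat"
  reals :: "nat \<Rightarrow> nat \<Rightarrow> real"
  drawn :: nat  \<comment> \<open>number of samples consumed so far; not accessible to the program\<close>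

fun nval :: "nat \<Rightarrow> state \<Rightarrow> nexp \<Rightarrow> nat" where
  "nval n s (NConst k) = k"
| "nval n s NSize = n"
| "nval n s (NGet a e) = nats s a (nval n s e)"
| "nval n s (NAdd e f) = nval n s e + nval n s f"
| "nval n s (NSub e f) = nval n s e - nval n s f"

fun rval :: "nat \<Rightarrow> (nat \<Rightarrow> nat \<Rightarrow> real) \<Rightarrow> real \<Rightarrow> state \<Rightarrow> rexp \<Rightarrow> real" where
  "rval n d \<Delta> s (RNat e) = real (nval n s e)"
| "rval n d \<Delta> s RDelta = \<Delta>"
| "rval n d \<Delta> s (RDist e f) =
     (if nval n s e < n \<and> nval n s f < n then d (nval n s e) (nval n s f) else 0)"
| "rval n d \<Delta> s (RGet a e) = reals s a (nval n s e)"
| "rval n d \<Delta> s (RAdd e f) = rval n d \<Delta> s e + rval n d \<Delta> s f"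
| "rval n d \<Delta> s (RSub e f) = rval n d \<Delta> s e - rval n d \<Delta> s f"
| "rval n d \<Delta> s (RMul e f) = rval n d \<Delta> s e * rval n d \<Delta> s f"
| "rval n d \<Delta> s (RDiv e f) = rval n d \<Delta> s e / rval n d \<Delta> s f"

fun bval :: "nat \<Rightarrow> (nat \<Rightarrow> nat \<Rightarrow> real) \<Rightarrow> real \<Rightarrow> state \<Rightarrow> bexp \<Rightarrow> bool" where
  "bval n d \<Delta> s (NLess e f) \<longleftrightarrow> nval n s e < nval n s f"
| "bval n d \<Delta> s (RLess e f) \<longleftrightarrow> rval n d \<Delta> s e < rval n d \<Delta> s f"
| "bval n d \<Delta> s (BNot b) \<longleftrightarrow> \<not> bval n d \<Delta> s b"
| "bval n d \<Delta> s (BAnd b c) \<longleftrightarrow> bval n d \<Delta> s b \<and> bval n d \<Delta> s c"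

definition upd :: "(nat \<Rightarrow> nat \<Rightarrow> 'v) \<Rightarrow> nat \<Rightarrow> nat \<Rightarrow> 'v \<Rightarrow> nat \<Rightarrow> nat \<Rightarrow> 'v" where
  "upd m a i x = m(a := (m a)(i := x))"

text \<open>
  \<open>exec n d \<Delta> \<omega> c s t s'\<close>: on the given input and with the outcome \<open>\<omega>\<close> of the random source,
  \<open>c\<close> started in \<open>s\<close> halts in \<open>s'\<close> after \<open>t\<close> steps. Every assignment, sample and evaluation of a
  guard is one step; expressions have constant size, as they are part of the program.
\<close>

inductive exec ::
  "nat \<Rightarrow> (nat \<Rightarrow> nat \<Rightarrow> real) \<Rightarrow> real \<Rightarrow> (nat \<Rightarrow> real) \<Rightarrow> com \<Rightarrow> state \<Rightarrow> nat \<Rightarrow> state \<Rightarrow> bool"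
  for n :: nat and d :: "nat \<Rightarrow> nat \<Rightarrow> real" and \<Delta> :: real and \<omega> :: "nat \<Rightarrow> real"
where
  Skip: "exec n d \<Delta> \<omega> Skip s 1 s"
| NSet: "exec n d \<Delta> \<omega> (NSet a i e) s 1
           (s\<lparr>nats := upd (nats s) a (nval n s i) (nval n s e)\<rparr>)"
| RSet: "exec n d \<Delta> \<omega> (RSet a i e) s 1
           (s\<lparr>reals := upd (reals s) a (nval n s i) (rval n d \<Delta> s e)\<rparr>)"
| Sample: "exec n d \<Delta> \<omega> (Sample a i) s 1
           (s\<lparr>reals := upd (reals s) a (nval n s i) (\<omega> (drawn s)), drawn := Suc (drawn s)\<rparr>)"
| Seq: "exec n d \<Delta> \<omega> c1 s t1 s1 \<Longrightarrow> exec n d \<Delta> \<omega> c2 s1 t2 s2 \<Longrightarrow>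
          exec n d \<Delta> \<omega> (Seq c1 c2) s (t1 + t2) s2"
| CondTrue: "bval n d \<Delta> s b \<Longrightarrow> exec n d \<Delta> \<omega> c1 s t s' \<Longrightarrow>
          exec n d \<Delta> \<omega> (Cond b c1 c2) s (Suc t) s'"
| CondFalse: "\<not> bval n d \<Delta> s b \<Longrightarrow> exec n d \<Delta> \<omega> c2 s t s' \<Longrightarrow>
          exec n d \<Delta> \<omega> (Cond b c1 c2) s (Suc t) s'"
| WhileFalse: "\<not> bval n d \<Delta> s b \<Longrightarrow> exec n d \<Delta> \<omega> (While b c) s 1 s"
| WhileTrue: "bval n d \<Delta> s b \<Longrightarrow> exec n d \<Delta> \<omega> c s t1 s1 \<Longrightarrow>
          exec n d \<Delta> \<omega> (While b c) s1 t2 s2 \<Longrightarrow>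
          exec n d \<Delta> \<omega> (While b c) s (Suc (t1 + t2)) s2"

inductive_cases exec_SkipE: "exec n d \<Delta> \<omega> Skip s t s'"
inductive_cases exec_NSetE: "exec n d \<Delta> \<omega> (NSet a i e) s t s'"
inductive_cases exec_RSetE: "exec n d \<Delta> \<omega> (RSet a i e) s t s'"
inductive_cases exec_SampleE: "exec n d \<Delta> \<omega> (Sample a i) s t s'"
inductive_cases exec_SeqE: "exec n d \<Delta> \<omega> (Seq c1 c2) s t s'"
inductive_cases exec_CondE: "exec n d \<Delta> \<omega> (Cond b c1 c2) s t s'"
inductive_cases exec_WhileE: "exec n d \<Delta> \<omega> (While b c) s t s'"

lemma exec_deterministic:
  "exec n d \<Delta> \<omega> c s t s' \<Longrightarrow> exec n d \<Delta> \<omega> c s t' s'' \<Longrightarrow> t' = t \<and> s'' = s'"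
proof (induction arbitrary: t' s'' rule: exec.induct)
  case (Seq c1 s t1 s1 c2 t2 s2)
  from Seq.prems show ?case
    by (rule exec_SeqE) (use Seq.IH in blast)
next
  case (CondTrue s b c1 t s' c2)
  from CondTrue.prems show ?case
    by (rule exec_CondE) (use CondTrue.IH CondTrue.hyps in blast)+
next
  case (CondFalse s b c2 t s' c1)
  from CondFalse.prems show ?case
    by (rule exec_CondE) (use CondFalse.IH CondFalse.hyps in blast)+
next
  case (WhileTrue s b c t1 s1 t2 s2)
  from WhileTrue.prems show ?case
    by (rule exec_WhileE) (use WhileTrue.IH WhileTrue.hyps in blast)+
qed (auto elim: exec_SkipE exec_NSetE exec_RSetE exec_SampleE exec_WhileE)

definition init_state :: state where
  "init_state = \<lparr>nats = (\<lambda>_ _. 0), reals = (\<lambda>_ _. 0), drawn = 0\<rparr>"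

text \<open>The random source: a sequence of independent uniform samples from \<open>[0,1]\<close>.\<close>

definition tape :: "(nat \<Rightarrow> real) measure" where
  "tape = Pi\<^sub>M UNIV (\<lambda>_. restrict_space lborel {0..1})"

lemma prob_space_tape: "prob_space tape"
  unfolding tape_def
  by (intro prob_space_PiM prob_space_restrict_space) auto

lemma space_tape: "space tape = {\<omega>. \<forall>i. 0 \<le> \<omega> i \<and> \<omega> i \<le> 1}"
  by (auto simp: tape_def space_PiM space_restrict_space PiE_def Pi_def)

text \<open>Worst case over all metric inputs and all outcomes of the random source.\<close>

definition polynomial_time :: "com \<Rightarrow> bool" where
  "polynomial_time prog \<longleftrightarrow>
     (\<exists>p :: nat poly. \<forall>n d \<Delta>. Metric_space {..<n} d \<longrightarrow> \<Delta> > 0 \<longrightarrow>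
       (\<forall>\<omega>\<in>space tape. \<exists>t s. exec n d \<Delta> \<omega> prog init_state t s \<and> t \<le> poly p n))"

definition final_state ::
  "com \<Rightarrow> nat \<Rightarrow> (nat \<Rightarrow> nat \<Rightarrow> real) \<Rightarrow> real \<Rightarrow> (nat \<Rightarrow> real) \<Rightarrow> state" where
  "final_state prog n d \<Delta> \<omega> = (THE s. \<exists>t. exec n d \<Delta> \<omega> prog init_state t s)"

lemma final_state_eq:
  "exec n d \<Delta> \<omega> prog init_state t s \<Longrightarrow> final_state prog n d \<Delta> \<omega> = s"
  unfolding final_state_def using exec_deterministic by blast

text \<open>
  The partition is returned as a labelling of the points, left in array \<open>0\<close> of the
  natural-number memory: two points are in the same part iff they have the same label.
\<close>

definition partition_of_labels :: "nat \<Rightarrow> (nat \<Rightarrow> nat) \<Rightarrow> nat set set" where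
  "partition_of_labels n l = (\<lambda>u. {v. v < n \<and> l v = l u}) ` {..<n}"

definition returned_partition ::
  "com \<Rightarrow> nat \<Rightarrow> (nat \<Rightarrow> nat \<Rightarrow> real) \<Rightarrow> real \<Rightarrow> (nat \<Rightarrow> real) \<Rightarrow> nat set set" where
  "returned_partition prog n d \<Delta> \<omega> = partition_of_labels n (nats (final_state prog n d \<Delta> \<omega>) 0)"


section \<open>Diameters, cuts and norms\<close>

text \<open>
  The same formula as the library's \<^const>\<open>diameter\<close>, which is tied to the distance of a type class.
\<close>

definition diam :: "('a \<Rightarrow> 'a \<Rightarrow> real) \<Rightarrow> 'a set \<Rightarrow> real" where
  "diam d S = (if S = {} then 0 else SUP (x, y)\<in>S \<times> S. d x y)"

text \<open>Edges are two-element sets, and the weight \<open>w\<^sub>u\<^sub>v\<close> is \<open>w {u, v}\<close>.\<close>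

definition weighted_graph :: "'a set \<Rightarrow> 'a set set \<Rightarrow> ('a set \<Rightarrow> real) \<Rightarrow> bool" where
  "weighted_graph X E w \<longleftrightarrow> (\<forall>e\<in>E. e \<subseteq> X \<and> card e = 2) \<and> (\<forall>e\<in>E. 0 \<le> w e)"

definition nbrs :: "'a set set \<Rightarrow> 'a \<Rightarrow> 'a set" where
  "nbrs E u = {v. {u, v} \<in> E}"

definition separated :: "'a set set \<Rightarrow> 'a \<Rightarrow> 'a \<Rightarrow> bool" where
  "separated \<P> u v \<longleftrightarrow> (\<exists>P\<in>\<P>. \<exists>Q\<in>\<P>. P \<noteq> Q \<and> u \<in> P \<and> v \<in> Q)"

definition cut :: "'a set set \<Rightarrow> 'a set set \<Rightarrow> ('a set \<Rightarrow> real) \<Rightarrow> 'a \<Rightarrow> real" where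
  "cut \<P> E w u = (\<Sum>v\<in>nbrs E u. w {u, v} * of_bool (separated \<P> u v))"

definition lq_norm :: "real \<Rightarrow> 'a set \<Rightarrow> ('a \<Rightarrow> real) \<Rightarrow> real" where
  "lq_norm q X x = (\<Sum>u\<in>X. x u powr q) powr (1 / q)"

end

theory Submission
  imports Defs
begin

text \<open>
  Let \<open>M\<close> be about \<open>5 \<surd>n\<close>. At \<open>u\<close>, the cut edges of length more than \<open>\<Delta>/M\<close> cost at most
  \<open>M \<Sum>\<^sub>v w\<^sub>u\<^sub>v d(u,v)/\<Delta>\<close>, and \<open>k\<close> cut edges of weights \<open>w\<^sub>i\<close> contribute at most \<open>k\<^sup>q\<^sup>-\<^sup>1 \<Sum>\<^sub>i w\<^sub>i\<^sup>q\<close> to the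
  \<open>q\<close>-th power of the norm. So it suffices that every edge is cut with probability
  \<open>O(log n) d(u,v)/\<Delta>\<close> and that at most \<open>M\<close> short edges are ever cut at the same vertex.

  The second condition concerns only the heavy points, whose \<open>\<Delta>/M\<close>-ball has more than \<open>M\<close>
  elements. They are covered by the balls of radius \<open>2\<Delta>/M\<close> about at most \<open>n/M\<close> net points. For
  each potential cluster centre \<open>c\<close>, the function \<open>d(c, _)\<close> is made constant on every ball of
  radius \<open>3\<Delta>/M\<close> about a net point by collapsing an interval of length \<open>6\<Delta>/M\<close> of its range. The
  result \<open>f\<^sub>c\<close> is still 1-Lipschitz and has lost at most \<open>6n\<Delta>/M\<^sup>2 \<le> \<Delta>/4\<close>.

  The partition is that of Calinescu, Karloff and Rabani with \<open>f\<^sub>c\<close> in place of \<open>d(c, _)\<close>: for a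
  radius \<open>R\<close> uniform in \<open>[0, \<Delta>/4]\<close> and independent uniform priorities, each \<open>u\<close> joins the centre
  \<open>c\<close> of least priority with \<open>f\<^sub>c(u) \<le> R\<close>. Two points at which all \<open>f\<^sub>c\<close> agree are never
  separated, whatever the outcome of the random source. This gives
  \<open>n\<^bsup>(q-1)/2q\<^esup> log\<^bsup>1/q\<^esup> n\<close>, which is within a constant of the required factor.
\<close>

section \<open>Execution with a step bound\<close>

text \<open>A weakest precondition with a step budget. Because \<open>T\<close> is only an upper
  bound, the two branches of a conditional and all rounds of a loop can share one budget.\<close>

definition steps ::
  "nat \<Rightarrow> (nat \<Rightarrow> nat \<Rightarrow> real) \<Rightarrow> real \<Rightarrow> (nat \<Rightarrow> real) \<Rightarrow> nat \<Rightarrow> com \<Rightarrow> (state \<Rightarrow> bool) \<Rightarrow> state \<Rightarrow> bool" where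
  "steps n d \<Delta> \<omega> T c Q s \<longleftrightarrow> (\<exists>t s'. exec n d \<Delta> \<omega> c s t s' \<and> t \<le> T \<and> Q s')"

lemma steps_weaken:
  assumes "steps n d \<Delta> \<omega> T c Q s" "T \<le> T'" "\<And>s'. Q s' \<Longrightarrow> Q' s'"
  shows "steps n d \<Delta> \<omega> T' c Q' s"
  using assms unfolding steps_def by (meson order_trans)

lemma steps_Seq:
  assumes "steps n d \<Delta> \<omega> T1 c1 P s" "\<And>s'. P s' \<Longrightarrow> steps n d \<Delta> \<omega> T2 c2 Q s'" "T1 + T2 \<le> T"
  shows "steps n d \<Delta> \<omega> T (Seq c1 c2) Q s"
proof -
  obtain t1 s1 where 1: "exec n d \<Delta> \<omega> c1 s t1 s1" "t1 \<le> T1" "P s1"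
    using assms(1) by (auto simp: steps_def)
  obtain t2 s2 where 2: "exec n d \<Delta> \<omega> c2 s1 t2 s2" "t2 \<le> T2" "Q s2"
    using assms(2)[OF 1(3)] by (auto simp: steps_def)
  show ?thesis
    unfolding steps_def using exec.Seq[OF 1(1) 2(1)] 1 2 assms(3)
    by (intro exI[of _ "t1 + t2"] exI[of _ s2]) auto
qed

lemma steps_atom:
  "1 \<le> T \<Longrightarrow> Q s \<Longrightarrow> steps n d \<Delta> \<omega> T Skip Q s"
  "1 \<le> T \<Longrightarrow> Q (s\<lparr>nats := upd (nats s) a (nval n s i) (nval n s e)\<rparr>) \<Longrightarrow>
     steps n d \<Delta> \<omega> T (NSet a i e) Q s"
  "1 \<le> T \<Longrightarrow> Q (s\<lparr>reals := upd (reals s) a (nval n s i) (rval n d \<Delta> s r)\<rparr>) \<Longrightarrow>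
     steps n d \<Delta> \<omega> T (RSet a i r) Q s"
  "1 \<le> T \<Longrightarrow> Q (s\<lparr>reals := upd (reals s) a (nval n s i) (\<omega> (drawn s)), drawn := Suc (drawn s)\<rparr>) \<Longrightarrow>
     steps n d \<Delta> \<omega> T (Sample a i) Q s"
  unfolding steps_def by (blast intro: exec.intros)+

lemma steps_Cond:
  assumes "1 \<le> T"
    and "bval n d \<Delta> s b \<Longrightarrow> steps n d \<Delta> \<omega> (T - 1) c1 Q s"
    and "\<not> bval n d \<Delta> s b \<Longrightarrow> steps n d \<Delta> \<omega> (T - 1) c2 Q s"
  shows "steps n d \<Delta> \<omega> T (Cond b c1 c2) Q s"
proof (cases "bval n d \<Delta> s b")
  case True
  then obtain t s' where "exec n d \<Delta> \<omega> c1 s t s'" "t \<le> T - 1" "Q s'"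
    using assms by (auto simp: steps_def)
  with True assms(1) show ?thesis
    unfolding steps_def by (intro exI[of _ "Suc t"] exI[of _ s']) (auto intro: exec.CondTrue)
next
  case False
  then obtain t s' where "exec n d \<Delta> \<omega> c2 s t s'" "t \<le> T - 1" "Q s'"
    using assms by (auto simp: steps_def)
  with False assms(1) show ?thesis
    unfolding steps_def by (intro exI[of _ "Suc t"] exI[of _ s']) (auto intro: exec.CondFalse)
qed

text \<open>Pushing the continuation into both branches spares an intermediate assertion, so that
  loop-free code can be executed symbolically from front to back.\<close>

lemma steps_Seq_Cond:
  assumes "1 \<le> T"
    and "bval n d \<Delta> s b \<Longrightarrow> steps n d \<Delta> \<omega> (T - 1) (Seq c1 c) Q s"
    and "\<not> bval n d \<Delta> s b \<Longrightarrow> steps n d \<Delta> \<omega> (T - 1) (Seq c2 c) Q s"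
  shows "steps n d \<Delta> \<omega> T (Seq (Cond b c1 c2) c) Q s"
proof (cases "bval n d \<Delta> s b")
  case True
  then obtain t s' where *: "exec n d \<Delta> \<omega> (Seq c1 c) s t s'" "t \<le> T - 1" "Q s'"
    using assms by (auto simp: steps_def)
  from *(1) obtain t1 t2 s1 where "exec n d \<Delta> \<omega> c1 s t1 s1" "exec n d \<Delta> \<omega> c s1 t2 s'" "t = t1 + t2"
    by (rule exec_SeqE) blast
  with True have "exec n d \<Delta> \<omega> (Seq (Cond b c1 c2) c) s (Suc t) s'"
    using exec.Seq[OF exec.CondTrue] by fastforce
  with * assms(1) show ?thesis
    unfolding steps_def by (intro exI[of _ "Suc t"] exI[of _ s']) auto
next
  case False
  then obtain t s' where *: "exec n d \<Delta> \<omega> (Seq c2 c) s t s'" "t \<le> T - 1" "Q s'"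
    using assms by (auto simp: steps_def)
  from *(1) obtain t1 t2 s1 where "exec n d \<Delta> \<omega> c2 s t1 s1" "exec n d \<Delta> \<omega> c s1 t2 s'" "t = t1 + t2"
    by (rule exec_SeqE) blast
  with False have "exec n d \<Delta> \<omega> (Seq (Cond b c1 c2) c) s (Suc t) s'"
    using exec.Seq[OF exec.CondFalse] by fastforce
  with * assms(1) show ?thesis
    unfolding steps_def by (intro exI[of _ "Suc t"] exI[of _ s']) auto
qed

lemma steps_Seq_atom:
  "1 \<le> T \<Longrightarrow> steps n d \<Delta> \<omega> (T - 1) c Q s \<Longrightarrow> steps n d \<Delta> \<omega> T (Seq Skip c) Q s"
  "1 \<le> T \<Longrightarrow> steps n d \<Delta> \<omega> (T - 1) c Q (s\<lparr>nats := upd (nats s) a (nval n s i) (nval n s e)\<rparr>) \<Longrightarrow>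
     steps n d \<Delta> \<omega> T (Seq (NSet a i e) c) Q s"
  "1 \<le> T \<Longrightarrow> steps n d \<Delta> \<omega> (T - 1) c Q (s\<lparr>reals := upd (reals s) a (nval n s i) (rval n d \<Delta> s r)\<rparr>) \<Longrightarrow>
     steps n d \<Delta> \<omega> T (Seq (RSet a i r) c) Q s"
  "1 \<le> T \<Longrightarrow> steps n d \<Delta> \<omega> (T - 1) c Q
     (s\<lparr>reals := upd (reals s) a (nval n s i) (\<omega> (drawn s)), drawn := Suc (drawn s)\<rparr>) \<Longrightarrow>
     steps n d \<Delta> \<omega> T (Seq (Sample a i) c) Q s"
  by (rule steps_Seq[where ?T1.0 = 1 and ?T2.0 = "T - 1"], rule steps_atom;
      (rule refl order.refl | simp | fastforce))+

text \<open>The index \<open>k\<close> counts the rounds done and \<open>m\<close> bounds them: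
  termination is the requirement that the guard holds under \<open>I k\<close> only while
  \<open>k < m\<close>. Each round pays \<open>T\<close> plus one for its guard; the failing guard
  pays the final 1.\<close>

lemma steps_While:
  assumes "I k s" and "k \<le> m"
    and "\<And>k s. I k s \<Longrightarrow> k \<le> m \<Longrightarrow> bval n d \<Delta> s b \<Longrightarrow>
           k < m \<and> steps n d \<Delta> \<omega> T c (I (Suc k)) s"
  shows "steps n d \<Delta> \<omega> ((m - k) * Suc T + 1) (While b c) (\<lambda>s. (\<exists>k\<le>m. I k s) \<and> \<not> bval n d \<Delta> s b) s"
  using assms(1,2)
proof (induction "m - k" arbitrary: k s rule: less_induct)
  case less
  show ?case
  proof (cases "bval n d \<Delta> s b")
    case False
    then show ?thesis
      using less.prems unfolding steps_def by (blast intro: exec.WhileFalse le_add2)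
  next
    case True
    then have k: "k < m" and body: "steps n d \<Delta> \<omega> T c (I (Suc k)) s"
      using assms(3) less.prems by blast+
    obtain t1 s1 where 1: "exec n d \<Delta> \<omega> c s t1 s1" "t1 \<le> T" "I (Suc k) s1"
      using body by (auto simp: steps_def)
    have "steps n d \<Delta> \<omega> ((m - Suc k) * Suc T + 1) (While b c)
            (\<lambda>s. (\<exists>k\<le>m. I k s) \<and> \<not> bval n d \<Delta> s b) s1"
      using k 1(3) by (intro less.hyps) auto
    then obtain t2 s2 where 2: "exec n d \<Delta> \<omega> (While b c) s1 t2 s2"
      "t2 \<le> (m - Suc k) * Suc T + 1" "\<exists>k\<le>m. I k s2" "\<not> bval n d \<Delta> s2 b"
      by (auto simp: steps_def)
    have "m - k = Suc (m - Suc k)"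
      using k by simp
    then have "Suc (t1 + t2) \<le> (m - k) * Suc T + 1"
      using 1(2) 2(2) by simp
    then show ?thesis
      unfolding steps_def using exec.WhileTrue[OF True 1(1) 2(1)] 2 by blast
  qed
qed

definition for_loop :: "nat \<Rightarrow> com \<Rightarrow> com" where
  "for_loop a c = Seq (NSet a (NConst 0) (NConst 0))
     (While (NLess (NGet a (NConst 0)) NSize)
       (Seq c (NSet a (NConst 0) (NAdd (NGet a (NConst 0)) (NConst 1)))))"

text \<open>The body must leave its counter alone, and the invariant is required for the state after
  the increment. A round costs the body, the increment and the guard, hence \<open>T + 2\<close>;
  the initialisation and the failing guard account for the last 2.\<close>

lemma steps_for_loop:
  assumes init: "I 0 (s\<lparr>nats := upd (nats s) a 0 0\<rparr>)"
    and body: "\<And>k s. I k s \<Longrightarrow> k < n \<Longrightarrow> nats s a 0 = k \<Longrightarrow>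
      steps n d \<Delta> \<omega> T c (\<lambda>s. nats s a 0 = k \<and> I (Suc k) (s\<lparr>nats := upd (nats s) a 0 (Suc k)\<rparr>)) s"
    and Q: "\<And>s. I n s \<Longrightarrow> Q s"
    and T: "n * (T + 2) + 2 \<le> T'"
  shows "steps n d \<Delta> \<omega> T' (for_loop a c) Q s"
  unfolding for_loop_def
proof (rule steps_Seq_atom)
  let ?J = "\<lambda>k s. nats s a 0 = k \<and> I k s"
  let ?b = "NLess (NGet a (NConst 0)) NSize"
  let ?c = "Seq c (NSet a (NConst 0) (NAdd (NGet a (NConst 0)) (NConst 1)))"
  show "1 \<le> T'" using T by simp
  have "steps n d \<Delta> \<omega> ((n - 0) * Suc (Suc T) + 1) (While ?b ?c)
          (\<lambda>s. (\<exists>k\<le>n. ?J k s) \<and> \<not> bval n d \<Delta> s ?b) (s\<lparr>nats := upd (nats s) a 0 0\<rparr>)"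
  proof (rule steps_While)
    show "?J 0 (s\<lparr>nats := upd (nats s) a 0 0\<rparr>)"
      using init by (simp add: upd_def)
  next
    fix k s assume k: "?J k s" "k \<le> n" "bval n d \<Delta> s ?b"
    then have "k < n" by simp
    moreover have "steps n d \<Delta> \<omega> (Suc T) ?c (?J (Suc k)) s"
      by (rule steps_Seq[OF body[of k s]]) (use k \<open>k < n\<close> in \<open>auto intro!: steps_atom(2) simp: upd_def\<close>)
    ultimately show "k < n \<and> steps n d \<Delta> \<omega> (Suc T) ?c (?J (Suc k)) s" ..
  qed simp
  then show "steps n d \<Delta> \<omega> (T' - 1) (While ?b ?c) Q
      (s\<lparr>nats := upd (nats s) a (nval n s (NConst 0)) (nval n s (NConst 0))\<rparr>)"
    unfolding nval.simps
  proof (rule steps_weaken)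
    show "(n - 0) * Suc (Suc T) + 1 \<le> T' - 1"
      using T by simp
  next
    fix s' assume *: "(\<exists>k\<le>n. ?J k s') \<and> \<not> bval n d \<Delta> s' ?b"
    then obtain k where "k \<le> n" "nats s' a 0 = k" "I k s'" "\<not> nats s' a 0 < n"
      by auto
    then show "Q s'" using Q by simp
  qed
qed

section \<open>The program\<close>

text \<open>The ceiling of the square root of \<open>24 * n\<close>. The 24 is 6 times 4: each of at
  most \<open>n / scale n\<close> collapses loses at most \<open>6 * \<Delta> / scale n\<close>, and
  the total loss may not exceed \<open>\<Delta> / 4\<close>.\<close>

definition scale :: "nat \<Rightarrow> nat" where
  "scale n = (LEAST m. 24 * n \<le> m * m)"

text \<open>For \<open>r >= 0\<close>, the monotone 1-Lipschitz map of the line that contracts an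
  interval of length \<open>r\<close> to its lower end and translates what lies above it.\<close>

definition squeeze :: "real \<Rightarrow> real \<Rightarrow> real \<Rightarrow> real" where
  "squeeze lo r x = (if lo < x then (if lo + r < x then x - r else lo) else x)"

text \<open>The closed ball of radius \<open>\<Delta> / scale n\<close>, multiplied out as in the
  comparison that the program makes.\<close>

definition near :: "nat \<Rightarrow> (nat \<Rightarrow> nat \<Rightarrow> real) \<Rightarrow> real \<Rightarrow> nat \<Rightarrow> nat set" where
  "near n d \<Delta> u = {v. v < n \<and> real (scale n) * d u v \<le> \<Delta>}"

text \<open>Greedy selection in index order among the heavy points, those with more than
  \<open>scale n\<close> points in their ball.\<close>

fun net :: "nat \<Rightarrow> (nat \<Rightarrow> nat \<Rightarrow> real) \<Rightarrow> real \<Rightarrow> nat \<Rightarrow> nat set" where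
  "net n d \<Delta> 0 = {}"
| "net n d \<Delta> (Suc u) =
     (if scale n < card (near n d \<Delta> u) \<and> (\<forall>g\<in>net n d \<Delta> u. 2 * \<Delta> < real (scale n) * d u g)
      then insert u (net n d \<Delta> u) else net n d \<Delta> u)"

text \<open>In \<open>profile n d \<Delta> c g g\<close> the first \<open>g\<close> is the stage and
  the second the point: the interval is centred at the value that the function collapsed so far
  takes at the net point.\<close>

fun profile :: "nat \<Rightarrow> (nat \<Rightarrow> nat \<Rightarrow> real) \<Rightarrow> real \<Rightarrow> nat \<Rightarrow> nat \<Rightarrow> nat \<Rightarrow> real" where
  "profile n d \<Delta> c 0 u = d c u"
| "profile n d \<Delta> c (Suc g) u =
     (if g \<in> net n d \<Delta> n
      then squeeze (profile n d \<Delta> c g g - 3 * \<Delta> / real (scale n)) (6 * \<Delta> / real (scale n))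
             (profile n d \<Delta> c g u)
      else profile n d \<Delta> c g u)"

text \<open>The initial value 2 exceeds every priority.\<close>

fun best :: "(nat \<Rightarrow> nat \<Rightarrow> real) \<Rightarrow> real \<Rightarrow> (nat \<Rightarrow> real) \<Rightarrow> nat \<Rightarrow> nat \<Rightarrow> real" where
  "best f R p 0 u = 2"
| "best f R p (Suc c) u = (if f c u \<le> R \<and> p c < best f R p c u then p c else best f R p c u)"

text \<open>The index at which \<open>best\<close> is attained. The strict comparison resolves ties
  in favour of the smaller index; 0 is a placeholder until some centre claims
  \<open>u\<close>.\<close>

fun label :: "(nat \<Rightarrow> nat \<Rightarrow> real) \<Rightarrow> real \<Rightarrow> (nat \<Rightarrow> real) \<Rightarrow> nat \<Rightarrow> nat \<Rightarrow> nat" where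
  "label f R p 0 u = 0"
| "label f R p (Suc c) u = (if f c u \<le> R \<and> p c < best f R p c u then c else label f R p c u)"

text \<open>
  Natural arrays: 0 labels, 1 membership in the net, 2 \<^const>\<open>scale\<close>, 3 to 5 loop counters,
  6 ball size, 7 flag for a close net point. Real arrays: 0 profile, 1 least priority so far,
  2 radius, 3 priority of the current centre, 4 lower end of the collapsed interval.
  Scalars live at index 0.
\<close>

abbreviation nvar :: "nat \<Rightarrow> nexp" where
  "nvar a \<equiv> NGet a (NConst 0)"

abbreviation rvar :: "nat \<Rightarrow> rexp" where
  "rvar a \<equiv> RGet a (NConst 0)"

abbreviation rnum :: "nat \<Rightarrow> rexp" where
  "rnum k \<equiv> RNat (NConst k)"

definition find_scale :: com where
  "find_scale = Seq (NSet 2 (NConst 0) (NConst 0))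
     (While (RLess (RMul (RNat (nvar 2)) (RNat (nvar 2))) (RMul (rnum 24) (RNat NSize)))
       (NSet 2 (NConst 0) (NAdd (nvar 2) (NConst 1))))"

definition scan :: com where
  "scan = for_loop 5 (Seq
     (Cond (RLess RDelta (RMul (RNat (nvar 2)) (RDist (nvar 3) (nvar 5))))
       Skip (NSet 6 (NConst 0) (NAdd (nvar 6) (NConst 1))))
     (Cond (BAnd (NLess (NConst 0) (NGet 1 (nvar 5)))
             (BNot (RLess (RMul (rnum 2) RDelta) (RMul (RNat (nvar 2)) (RDist (nvar 3) (nvar 5))))))
       (NSet 7 (NConst 0) (NConst 1)) Skip))"

definition find_net :: com where
  "find_net = for_loop 3
     (Seq (NSet 6 (NConst 0) (NConst 0)) (Seq (NSet 7 (NConst 0) (NConst 0)) (Seq scan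
       (Cond (BAnd (NLess (nvar 2) (nvar 6)) (NLess (nvar 7) (NConst 1)))
         (NSet 1 (nvar 3) (NConst 1)) Skip))))"

definition squeeze_all :: com where
  "squeeze_all = for_loop 5
     (Cond (RLess (rvar 4) (RGet 0 (nvar 5)))
       (Cond (RLess (RAdd (rvar 4) (RDiv (RMul (rnum 6) RDelta) (RNat (nvar 2)))) (RGet 0 (nvar 5)))
         (RSet 0 (nvar 5) (RSub (RGet 0 (nvar 5)) (RDiv (RMul (rnum 6) RDelta) (RNat (nvar 2)))))
         (RSet 0 (nvar 5) (rvar 4)))
       Skip)"

text \<open>The lower end of the interval is saved in real array 4 before the sweep, since the sweep
  may overwrite the value at the net point itself.\<close>

definition find_profile :: com where
  "find_profile = Seq (for_loop 5 (RSet 0 (nvar 5) (RDist (nvar 3) (nvar 5))))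
     (for_loop 4 (Cond (NLess (NConst 0) (NGet 1 (nvar 4)))
       (Seq (RSet 4 (NConst 0)
              (RSub (RGet 0 (nvar 4)) (RDiv (RMul (rnum 3) RDelta) (RNat (nvar 2)))))
         squeeze_all)
       Skip))"

definition claim :: com where
  "claim = for_loop 5
     (Cond (BAnd (BNot (RLess (rvar 2) (RGet 0 (nvar 5)))) (RLess (rvar 3) (RGet 1 (nvar 5))))
       (Seq (RSet 1 (nvar 5) (rvar 3)) (NSet 0 (nvar 5) (nvar 3))) Skip)"

text \<open>Draw 0 becomes the radius and draw \<open>Suc c\<close> the priority of centre
  \<open>c\<close>. The net is deterministic and is computed before any sampling.\<close>

definition program :: com where
  "program = Seq find_scale (Seq find_net
     (Seq (Sample 2 (NConst 0))
     (Seq (RSet 2 (NConst 0) (RDiv (RMul RDelta (rvar 2)) (rnum 4)))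
     (Seq (for_loop 3 (RSet 1 (nvar 3) (rnum 2)))
       (for_loop 3 (Seq (Sample 3 (NConst 0)) (Seq find_profile claim)))))))"

text \<open>A frame condition: \<open>A\<close> and \<open>B\<close> list the natural and the real
  arrays that may have changed.\<close>

definition same :: "nat set \<Rightarrow> nat set \<Rightarrow> state \<Rightarrow> state \<Rightarrow> bool" where
  "same A B s s' \<longleftrightarrow> (\<forall>a. a \<notin> A \<longrightarrow> nats s' a = nats s a) \<and> (\<forall>a. a \<notin> B \<longrightarrow> reals s' a = reals s a)"

section \<open>Correctness and running time of the components of the program\<close>

lemmas steps_intros = steps_Seq_Cond steps_Seq_atom steps_Cond steps_atom

lemma scale_sq: "24 * n \<le> scale n * scale n"
  unfolding scale_def by (rule LeastI[of _ "24 * n"]) simp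

lemma scale_least: "k < scale n \<Longrightarrow> k * k < 24 * n"
  unfolding scale_def using not_less_Least by fastforce

lemma scale_le: "scale n \<le> 24 * n"
  unfolding scale_def by (rule Least_le) simp

lemma steps_find_scale:
  "steps n d \<Delta> \<omega> (48 * n + 2) find_scale
     (\<lambda>s'. same {2} {} s s' \<and> drawn s' = drawn s \<and> nats s' 2 0 = scale n) s"
  unfolding find_scale_def
proof (rule steps_Seq_atom)
  let ?b = "RLess (RMul (RNat (nvar 2)) (RNat (nvar 2))) (RMul (rnum 24) (RNat NSize))"
  let ?I = "\<lambda>k s'. same {2} {} s s' \<and> drawn s' = drawn s \<and> nats s' 2 0 = k"
  let ?c = "NSet 2 (NConst 0) (NAdd (nvar 2) (NConst 1))"
  \<comment> \<open>The machine cannot multiply naturals, so the guard compares squares as reals;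
    this brings it back to naturals.\<close>
  have b: "bval n d \<Delta> s' ?b \<longleftrightarrow> nats s' 2 0 * nats s' 2 0 < 24 * n" for s'
    using of_nat_less_iff[of "nats s' 2 0 * nats s' 2 0" "24 * n", where 'a = real]
    unfolding of_nat_mult by simp
  have "steps n d \<Delta> \<omega> ((scale n - 0) * Suc 1 + 1) (While ?b ?c)
          (\<lambda>s'. (\<exists>k\<le>scale n. ?I k s') \<and> \<not> bval n d \<Delta> s' ?b)
          (s\<lparr>nats := upd (nats s) 2 0 0\<rparr>)"
  proof (rule steps_While)
    fix k s' assume k: "?I k s'" "k \<le> scale n" "bval n d \<Delta> s' ?b"
    then have "k \<noteq> scale n"
      using scale_sq[of n] b[of s'] by (metis leD)
    with k show "k < scale n \<and> steps n d \<Delta> \<omega> 1 ?c (?I (Suc k)) s'"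
      by (auto intro!: steps_atom simp: upd_def same_def)
  qed (auto simp: same_def upd_def)
  then show "steps n d \<Delta> \<omega> (48 * n + 2 - 1) (While ?b ?c)
      (\<lambda>s'. same {2} {} s s' \<and> drawn s' = drawn s \<and> nats s' 2 0 = scale n)
      (s\<lparr>nats := upd (nats s) 2 (nval n s (NConst 0)) (nval n s (NConst 0))\<rparr>)"
    unfolding nval.simps
  proof (rule steps_weaken)
    show "(scale n - 0) * Suc 1 + 1 \<le> 48 * n + 2 - 1"
      using scale_le[of n] by simp
  next
    fix s' assume *: "(\<exists>k\<le>scale n. ?I k s') \<and> \<not> bval n d \<Delta> s' ?b"
    then obtain k where k: "k \<le> scale n" "?I k s'" by blast
    with * b[of s'] have "\<not> k * k < 24 * n" by auto
    with k scale_least[of k n] have "k = scale n" by force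
    with k show "same {2} {} s s' \<and> drawn s' = drawn s \<and> nats s' 2 0 = scale n" by blast
  qed
qed simp

text \<open>\<open>G\<close> stands for the part of the net chosen before \<open>u\<close>, which
  array 1 holds when the outer loop reaches \<open>u\<close>. The two conditionals of a round take
  four steps.\<close>

lemma steps_scan:
  assumes "nats s 2 0 = scale n" "nats s 3 0 = u" "u < n"
    and "nats s 6 0 = 0" "nats s 7 0 = 0" "\<And>v. v < n \<Longrightarrow> 0 < nats s 1 v \<longleftrightarrow> v \<in> G" "G \<subseteq> {..<n}"
  shows "steps n d \<Delta> \<omega> (6 * n + 2) scan
     (\<lambda>s'. same {5,6,7} {} s s' \<and> drawn s' = drawn s \<and> nats s' 6 0 = card (near n d \<Delta> u) \<and>
       (nats s' 7 0 < 1 \<longleftrightarrow> (\<forall>g\<in>G. 2 * \<Delta> < real (scale n) * d u g))) s"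
  unfolding scan_def
proof (rule steps_for_loop[where T = 4 and I = "\<lambda>k s'. same {5,6,7} {} s s' \<and> drawn s' = drawn s \<and>
     nats s' 6 0 = card (near n d \<Delta> u \<inter> {..<k}) \<and>
     (nats s' 7 0 < 1 \<longleftrightarrow> (\<forall>g\<in>G \<inter> {..<k}. 2 * \<Delta> < real (scale n) * d u g))"])
  fix k s' assume I: "same {5,6,7} {} s s' \<and> drawn s' = drawn s \<and>
     nats s' 6 0 = card (near n d \<Delta> u \<inter> {..<k}) \<and>
     (nats s' 7 0 < 1 \<longleftrightarrow> (\<forall>g\<in>G \<inter> {..<k}. 2 * \<Delta> < real (scale n) * d u g))"
    and k: "k < n" "nats s' 5 0 = k"
  have I1: "nats s' a = nats s a" if "a \<noteq> 5" "a \<noteq> 6" "a \<noteq> 7" for a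
    using I that by (simp add: same_def)
  have I2: "reals s' = reals s" "drawn s' = drawn s" "nats s' 6 0 = card (near n d \<Delta> u \<inter> {..<k})"
    "nats s' 7 0 = 0 \<longleftrightarrow> (\<forall>g\<in>G \<inter> {..<k}. 2 * \<Delta> < real (scale n) * d u g)"
    using I by (auto simp: same_def)
  have 2: "card (near n d \<Delta> u \<inter> {..<Suc k}) =
     (if \<Delta> < real (scale n) * d u k then card (near n d \<Delta> u \<inter> {..<k})
      else Suc (card (near n d \<Delta> u \<inter> {..<k})))"
  proof -
    have "near n d \<Delta> u \<inter> {..<Suc k} =
       (if \<Delta> < real (scale n) * d u k then near n d \<Delta> u \<inter> {..<k}
        else insert k (near n d \<Delta> u \<inter> {..<k}))"
      using k by (auto simp: near_def less_Suc_eq)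
    then show ?thesis by simp
  qed
  have 3: "G \<inter> {..<Suc k} = (if 0 < nats s (Suc 0) k then insert k (G \<inter> {..<k}) else G \<inter> {..<k})"
    using assms(6) k by (auto simp: less_Suc_eq)
  show "steps n d \<Delta> \<omega> 4
     (Seq (Cond (RLess RDelta (RMul (RNat (nvar 2)) (RDist (nvar 3) (nvar 5))))
       Skip (NSet 6 (NConst 0) (NAdd (nvar 6) (NConst 1))))
     (Cond (BAnd (NLess (NConst 0) (NGet 1 (nvar 5)))
             (BNot (RLess (RMul (rnum 2) RDelta) (RMul (RNat (nvar 2)) (RDist (nvar 3) (nvar 5))))))
       (NSet 7 (NConst 0) (NConst 1)) Skip))
     (\<lambda>s'. nats s' 5 0 = k \<and> same {5,6,7} {} s (s'\<lparr>nats := upd (nats s') 5 0 (Suc k)\<rparr>) \<and>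
       drawn (s'\<lparr>nats := upd (nats s') 5 0 (Suc k)\<rparr>) = drawn s \<and>
       nats (s'\<lparr>nats := upd (nats s') 5 0 (Suc k)\<rparr>) 6 0 = card (near n d \<Delta> u \<inter> {..<Suc k}) \<and>
       (nats (s'\<lparr>nats := upd (nats s') 5 0 (Suc k)\<rparr>) 7 0 < 1 \<longleftrightarrow>
         (\<forall>g\<in>G \<inter> {..<Suc k}. 2 * \<Delta> < real (scale n) * d u g))) s'"
    by (intro steps_intros; simp add: I1 I2 assms k upd_def 2 3 same_def; auto)
qed (use assms in \<open>auto simp: same_def upd_def near_def Int_absorb2 intro!: arg_cong[where f = card]\<close>)

lemma net_subset: "net n d \<Delta> k \<subseteq> {..<k}"
  by (induction k) (auto simp: less_Suc_eq)

lemma steps_find_net: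
  assumes "nats s 2 0 = scale n" "\<And>v. nats s 1 v = 0"
  shows "steps n d \<Delta> \<omega> (n * (6 * n + 9) + 2) find_net
     (\<lambda>s'. same {1,3,5,6,7} {} s s' \<and> drawn s' = drawn s \<and>
       (\<forall>v. 0 < nats s' 1 v \<longleftrightarrow> v \<in> net n d \<Delta> n)) s"
  unfolding find_net_def
proof (rule steps_for_loop[where T = "6 * n + 7" and I = "\<lambda>k s'. same {1,3,5,6,7} {} s s' \<and>
     drawn s' = drawn s \<and> (\<forall>v. 0 < nats s' 1 v \<longleftrightarrow> v \<in> net n d \<Delta> k)"])
  fix k s' assume I: "same {1,3,5,6,7} {} s s' \<and> drawn s' = drawn s \<and>
      (\<forall>v. 0 < nats s' 1 v \<longleftrightarrow> v \<in> net n d \<Delta> k)"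
    and k: "k < n" "nats s' 3 0 = k"
  let ?s = "s'\<lparr>nats := upd (nats s') 6 0 0,
     nats := upd (nats (s'\<lparr>nats := upd (nats s') 6 0 0\<rparr>)) 7 0 0\<rparr>"
  have scan: "steps n d \<Delta> \<omega> (6 * n + 2) scan
     (\<lambda>s'. same {5,6,7} {} ?s s' \<and> drawn s' = drawn ?s \<and> nats s' 6 0 = card (near n d \<Delta> k) \<and>
       (nats s' 7 0 < 1 \<longleftrightarrow> (\<forall>g\<in>net n d \<Delta> k. 2 * \<Delta> < real (scale n) * d k g))) ?s"
    using I k assms net_subset[of n d \<Delta> k] by (intro steps_scan) (auto simp: upd_def same_def)
  show "steps n d \<Delta> \<omega> (6 * n + 7)
     (Seq (NSet 6 (NConst 0) (NConst 0)) (Seq (NSet 7 (NConst 0) (NConst 0)) (Seq scan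
       (Cond (BAnd (NLess (nvar 2) (nvar 6)) (NLess (nvar 7) (NConst 1)))
         (NSet 1 (nvar 3) (NConst 1)) Skip))))
     (\<lambda>s'. nats s' 3 0 = k \<and> same {1,3,5,6,7} {} s (s'\<lparr>nats := upd (nats s') 3 0 (Suc k)\<rparr>) \<and>
       drawn (s'\<lparr>nats := upd (nats s') 3 0 (Suc k)\<rparr>) = drawn s \<and>
       (\<forall>v. 0 < nats (s'\<lparr>nats := upd (nats s') 3 0 (Suc k)\<rparr>) 1 v \<longleftrightarrow> v \<in> net n d \<Delta> (Suc k))) s'"
  proof (intro steps_Seq_atom, unfold nval.simps, goal_cases)
    case 3
    show ?case
    proof (rule steps_Seq[OF scan, where ?T2.0 = 2], goal_cases)
      case (1 t)
      have t: "nats t a = nats s' a" if "a \<noteq> 5" "a \<noteq> 6" "a \<noteq> 7" for a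
        using 1 that by (simp add: same_def upd_def)
      have t': "reals t = reals s'" "drawn t = drawn s'" "nats t 6 0 = card (near n d \<Delta> k)"
        "nats t 7 0 = 0 \<longleftrightarrow> (\<forall>g\<in>net n d \<Delta> k. 2 * \<Delta> < real (scale n) * d k g)"
        using 1 by (auto simp: same_def)
      have I1: "nats s' a = nats s a" if "a \<noteq> 1" "a \<noteq> 3" "a \<noteq> 5" "a \<noteq> 6" "a \<noteq> 7" for a
        using I that by (simp add: same_def)
      have I2: "reals s' = reals s" "drawn s' = drawn s" "0 < nats s' (Suc 0) v \<longleftrightarrow> v \<in> net n d \<Delta> k" for v
        using I by (auto simp: same_def)
      show ?case
        by (intro steps_intros; simp add: I1 I2 t t' assms k upd_def same_def; auto)
    qed simp
  qed simp_all
qed (use assms in \<open>auto simp: same_def upd_def\<close>)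

lemma steps_squeeze_all:
  assumes "nats s 2 0 = scale n"
  shows "steps n d \<Delta> \<omega> (n * 5 + 2) squeeze_all
     (\<lambda>s'. same {5} {0} s s' \<and> drawn s' = drawn s \<and>
       (\<forall>u<n. reals s' 0 u = squeeze (reals s 4 0) (6 * \<Delta> / real (scale n)) (reals s 0 u))) s"
  unfolding squeeze_all_def
proof (rule steps_for_loop[where T = 3 and I = "\<lambda>k s'. same {5} {0} s s' \<and> drawn s' = drawn s \<and>
     (\<forall>u<n. reals s' 0 u =
       (if u < k then squeeze (reals s 4 0) (6 * \<Delta> / real (scale n)) (reals s 0 u) else reals s 0 u))"])
  fix k s' assume I: "same {5} {0} s s' \<and> drawn s' = drawn s \<and>
     (\<forall>u<n. reals s' 0 u =
       (if u < k then squeeze (reals s 4 0) (6 * \<Delta> / real (scale n)) (reals s 0 u) else reals s 0 u))"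
    and k: "k < n" "nats s' 5 0 = k"
  have I1: "nats s' a = nats s a" if "a \<noteq> 5" for a
    using I that by (simp add: same_def)
  have I2: "reals s' a = reals s a" if "a \<noteq> 0" for a
    using I that by (simp add: same_def)
  have I3: "drawn s' = drawn s" "reals s' 0 k = reals s 0 k"
     "\<And>u. u < k \<Longrightarrow> reals s' 0 u = squeeze (reals s 4 0) (6 * \<Delta> / real (scale n)) (reals s 0 u)"
     "\<And>u. u < n \<Longrightarrow> \<not> u < k \<Longrightarrow> reals s' 0 u = reals s 0 u"
    using I k(1) by auto
  show "steps n d \<Delta> \<omega> 3
     (Cond (RLess (rvar 4) (RGet 0 (nvar 5)))
       (Cond (RLess (RAdd (rvar 4) (RDiv (RMul (rnum 6) RDelta) (RNat (nvar 2)))) (RGet 0 (nvar 5)))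
         (RSet 0 (nvar 5) (RSub (RGet 0 (nvar 5)) (RDiv (RMul (rnum 6) RDelta) (RNat (nvar 2)))))
         (RSet 0 (nvar 5) (rvar 4)))
       Skip)
     (\<lambda>s'. nats s' 5 0 = k \<and> same {5} {0} s (s'\<lparr>nats := upd (nats s') 5 0 (Suc k)\<rparr>) \<and>
       drawn (s'\<lparr>nats := upd (nats s') 5 0 (Suc k)\<rparr>) = drawn s \<and>
       (\<forall>u<n. reals (s'\<lparr>nats := upd (nats s') 5 0 (Suc k)\<rparr>) 0 u =
         (if u < Suc k then squeeze (reals s 4 0) (6 * \<Delta> / real (scale n)) (reals s 0 u)
          else reals s 0 u))) s'"
    by (intro steps_intros; simp add: I1 I2 I3 assms k upd_def same_def; auto simp: squeeze_def I3 less_Suc_eq)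
qed (use assms in \<open>auto simp: same_def upd_def\<close>)

text \<open>One round of the recursions for \<open>best\<close> and \<open>label\<close>, carried
  out at all points. Stating it for pairs lets a single test govern both components.\<close>

lemma steps_claim:
  assumes "nats s 3 0 = c"
  shows "steps n d \<Delta> \<omega> (n * 5 + 2) claim
     (\<lambda>s'. same {0,5} {1} s s' \<and> drawn s' = drawn s \<and>
       (\<forall>u<n. (reals s' 1 u, nats s' 0 u) =
         (if reals s 0 u \<le> reals s 2 0 \<and> reals s 3 0 < reals s 1 u then (reals s 3 0, c)
          else (reals s 1 u, nats s 0 u)))) s"
  unfolding claim_def
proof (rule steps_for_loop[where T = 3 and I = "\<lambda>k s'. same {0,5} {1} s s' \<and> drawn s' = drawn s \<and>
     (\<forall>u<n. (reals s' 1 u, nats s' 0 u) =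
         (if u < k \<and> reals s 0 u \<le> reals s 2 0 \<and> reals s 3 0 < reals s 1 u then (reals s 3 0, c)
          else (reals s 1 u, nats s 0 u)))"])
  fix k s' assume I: "same {0,5} {1} s s' \<and> drawn s' = drawn s \<and>
     (\<forall>u<n. (reals s' 1 u, nats s' 0 u) =
         (if u < k \<and> reals s 0 u \<le> reals s 2 0 \<and> reals s 3 0 < reals s 1 u then (reals s 3 0, c)
          else (reals s 1 u, nats s 0 u)))"
    and k: "k < n" "nats s' 5 0 = k"
  have I1: "nats s' a = nats s a" if "a \<noteq> 0" "a \<noteq> 5" for a
    using I that by (simp add: same_def)
  have I2: "reals s' a = reals s a" if "a \<noteq> 1" for a
    using I that by (simp add: same_def)
  have I3: "drawn s' = drawn s" "reals s' (Suc 0) k = reals s (Suc 0) k"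
     "\<And>u. u < n \<Longrightarrow> reals s' (Suc 0) u =
         (if u < k \<and> reals s 0 u \<le> reals s 2 0 \<and> reals s 3 0 < reals s 1 u then reals s 3 0
          else reals s 1 u)"
     "\<And>u. u < n \<Longrightarrow> nats s' 0 u =
         (if u < k \<and> reals s 0 u \<le> reals s 2 0 \<and> reals s 3 0 < reals s 1 u then c
          else nats s 0 u)"
    using I k(1) by (auto split: if_splits)
  show "steps n d \<Delta> \<omega> 3
     (Cond (BAnd (BNot (RLess (rvar 2) (RGet 0 (nvar 5)))) (RLess (rvar 3) (RGet 1 (nvar 5))))
       (Seq (RSet 1 (nvar 5) (rvar 3)) (NSet 0 (nvar 5) (nvar 3))) Skip)
     (\<lambda>s'. nats s' 5 0 = k \<and> same {0,5} {1} s (s'\<lparr>nats := upd (nats s') 5 0 (Suc k)\<rparr>) \<and>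
       drawn (s'\<lparr>nats := upd (nats s') 5 0 (Suc k)\<rparr>) = drawn s \<and>
       (\<forall>u<n. (reals (s'\<lparr>nats := upd (nats s') 5 0 (Suc k)\<rparr>) 1 u,
           nats (s'\<lparr>nats := upd (nats s') 5 0 (Suc k)\<rparr>) 0 u) =
         (if u < Suc k \<and> reals s 0 u \<le> reals s 2 0 \<and> reals s 3 0 < reals s 1 u then (reals s 3 0, c)
          else (reals s 1 u, nats s 0 u)))) s'"
    by (intro steps_intros; simp add: I1 I2 I3 assms k upd_def same_def; auto simp: I3 less_Suc_eq)
qed (use assms in \<open>auto simp: same_def upd_def\<close>)

lemma steps_find_profile:
  assumes "nats s 2 0 = scale n" "nats s 3 0 = c" "c < n"
    and "\<And>v. 0 < nats s 1 v \<longleftrightarrow> v \<in> net n d \<Delta> n"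
  shows "steps n d \<Delta> \<omega> (n * 3 + 2 + (n * (n * 5 + 6) + 2)) find_profile
     (\<lambda>s'. same {4,5} {0,4} s s' \<and> drawn s' = drawn s \<and>
       (\<forall>u<n. reals s' 0 u = profile n d \<Delta> c n u)) s"
  unfolding find_profile_def
proof (rule steps_Seq[where P = "\<lambda>s'. same {4,5} {0,4} s s' \<and> drawn s' = drawn s \<and>
       (\<forall>u<n. reals s' 0 u = d c u)"])
  show "steps n d \<Delta> \<omega> (n * 3 + 2) (for_loop 5 (RSet 0 (nvar 5) (RDist (nvar 3) (nvar 5))))
     (\<lambda>s'. same {4,5} {0,4} s s' \<and> drawn s' = drawn s \<and> (\<forall>u<n. reals s' 0 u = d c u)) s"
  proof (rule steps_for_loop[where T = 1 and I = "\<lambda>k s'. same {4,5} {0,4} s s' \<and>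
      drawn s' = drawn s \<and> (\<forall>u<k. reals s' 0 u = d c u)"])
    fix k s' assume "same {4,5} {0,4} s s' \<and> drawn s' = drawn s \<and> (\<forall>u<k. reals s' 0 u = d c u)"
      "k < n" "nats s' 5 0 = k"
    with assms show "steps n d \<Delta> \<omega> 1 (RSet 0 (nvar 5) (RDist (nvar 3) (nvar 5)))
       (\<lambda>s'. nats s' 5 0 = k \<and> same {4,5} {0,4} s (s'\<lparr>nats := upd (nats s') 5 0 (Suc k)\<rparr>) \<and>
         drawn (s'\<lparr>nats := upd (nats s') 5 0 (Suc k)\<rparr>) = drawn s \<and>
         (\<forall>u<Suc k. reals (s'\<lparr>nats := upd (nats s') 5 0 (Suc k)\<rparr>) 0 u = d c u)) s'"
      by (intro steps_intros; simp add: upd_def same_def less_Suc_eq)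
  qed (auto simp: same_def upd_def)
next
  fix s1 assume s1: "same {4,5} {0,4} s s1 \<and> drawn s1 = drawn s \<and> (\<forall>u<n. reals s1 0 u = d c u)"
  show "steps n d \<Delta> \<omega> (n * (n * 5 + 6) + 2) (for_loop 4 (Cond (NLess (NConst 0) (NGet 1 (nvar 4)))
       (Seq (RSet 4 (NConst 0)
              (RSub (RGet 0 (nvar 4)) (RDiv (RMul (rnum 3) RDelta) (RNat (nvar 2)))))
         squeeze_all)
       Skip))
     (\<lambda>s'. same {4,5} {0,4} s s' \<and> drawn s' = drawn s \<and>
       (\<forall>u<n. reals s' 0 u = profile n d \<Delta> c n u)) s1"
  proof (rule steps_for_loop[where T = "n * 5 + 4" and I = "\<lambda>k s'. same {4,5} {0,4} s s' \<and>
      drawn s' = drawn s \<and> (\<forall>u<n. reals s' 0 u = profile n d \<Delta> c k u)"])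
    fix k s' assume I: "same {4,5} {0,4} s s' \<and> drawn s' = drawn s \<and>
        (\<forall>u<n. reals s' 0 u = profile n d \<Delta> c k u)"
      and k: "k < n" "nats s' 4 0 = k"
    have I1: "nats s' a = nats s a" if "a \<noteq> 4" "a \<noteq> 5" for a
      using I that by (simp add: same_def)
    have I2: "reals s' a = reals s a" if "a \<noteq> 0" "a \<noteq> 4" for a
      using I that by (simp add: same_def)
    have I3: "drawn s' = drawn s" "\<And>u. u < n \<Longrightarrow> reals s' 0 u = profile n d \<Delta> c k u"
      using I by auto
    have G: "0 < nats s (Suc 0) v \<longleftrightarrow> v \<in> net n d \<Delta> n" for v
      using assms(4) by simp
    let ?Q = "\<lambda>s'. nats s' 4 0 = k \<and> same {4,5} {0,4} s (s'\<lparr>nats := upd (nats s') 4 0 (Suc k)\<rparr>) \<and>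
         drawn (s'\<lparr>nats := upd (nats s') 4 0 (Suc k)\<rparr>) = drawn s \<and>
         (\<forall>u<n. reals (s'\<lparr>nats := upd (nats s') 4 0 (Suc k)\<rparr>) 0 u = profile n d \<Delta> c (Suc k) u)"
    show "steps n d \<Delta> \<omega> (n * 5 + 4) (Cond (NLess (NConst 0) (NGet 1 (nvar 4)))
       (Seq (RSet 4 (NConst 0)
              (RSub (RGet 0 (nvar 4)) (RDiv (RMul (rnum 3) RDelta) (RNat (nvar 2)))))
         squeeze_all)
       Skip) ?Q s'"
    proof (intro steps_intros, goal_cases)
      case 3
      let ?s = "s'\<lparr>reals := upd (reals s') 4 (nval n s' (NConst 0))
        (rval n d \<Delta> s' (RSub (RGet 0 (nvar 4)) (RDiv (RMul (rnum 3) RDelta) (RNat (nvar 2)))))\<rparr>"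
      have kG: "k \<in> net n d \<Delta> n"
        using 3 by (simp add: I1 k G)
      have "nats ?s 2 0 = scale n"
        by (simp add: I1 assms)
      from steps_squeeze_all[OF this] show ?case
      proof (rule steps_weaken)
        fix t assume "same {5} {0} ?s t \<and> drawn t = drawn ?s \<and>
          (\<forall>u<n. reals t 0 u = squeeze (reals ?s 4 0) (6 * \<Delta> / real (scale n)) (reals ?s 0 u))"
        then show "?Q t"
          by (simp add: I1 I2 I3 assms k kG upd_def same_def)
      qed simp
    qed (simp_all add: I1 I2 I3 G assms k upd_def same_def)
  qed (use s1 in \<open>auto simp: same_def upd_def\<close>)
qed simp

definition time_bound :: "nat \<Rightarrow> nat" where
  "time_bound n = 48 * n + 2 + (n * (6 * n + 9) + 2) + 2 + (n * 3 + 2) +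
     (n * (1 + (n * 3 + 2 + (n * (n * 5 + 6) + 2)) + (n * 5 + 2) + 2) + 2)"

text \<open>All loop bounds depend on \<open>n\<close> alone, so halting and the output are obtained
  for arbitrary \<open>d\<close>, \<open>\<Delta>\<close> and \<open>\<omega>\<close>. The cubic
  term of the bound comes from squeezing every point at every net point for every centre.\<close>

lemma steps_program:
  "steps n d \<Delta> \<omega> (time_bound n) program (\<lambda>s. \<forall>u<n. nats s 0 u =
     label (\<lambda>c. profile n d \<Delta> c n) (\<Delta> * \<omega> 0 / 4) (\<lambda>c. \<omega> (Suc c)) n u) init_state"
  unfolding program_def
proof (rule steps_Seq[OF steps_find_scale, where ?T2.0 = "n * (6 * n + 9) + 2 + (2 + (n * 3 + 2) +
      (n * (1 + (n * 3 + 2 + (n * (n * 5 + 6) + 2)) + (n * 5 + 2) + 2) + 2))"],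
    rule steps_Seq[OF steps_find_net, where ?T2.0 = "2 + (n * 3 + 2) +
      (n * (1 + (n * 3 + 2 + (n * (n * 5 + 6) + 2)) + (n * 5 + 2) + 2) + 2)"], goal_cases)
  case (3 s1 s2)
  let ?f = "\<lambda>c. profile n d \<Delta> c n" and ?R = "\<Delta> * \<omega> 0 / 4" and ?p = "\<lambda>c. \<omega> (Suc c)"
  let ?G = "\<lambda>s :: state. nats s 2 0 = scale n \<and> (\<forall>v. 0 < nats s 1 v \<longleftrightarrow> v \<in> net n d \<Delta> n)"
  have s2: "?G s2" "drawn s2 = 0" "\<And>u. nats s2 0 u = 0"
    using 3 by (auto simp: same_def init_state_def)
  have c1: "steps n d \<Delta> \<omega> (n * 3 + 2) (for_loop 3 (RSet 1 (nvar 3) (rnum 2)))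
     (\<lambda>s'. same {3} {1} s s' \<and> drawn s' = drawn s \<and> (\<forall>u<n. reals s' 1 u = 2)) s" for s
  proof (rule steps_for_loop[where T = 1 and I = "\<lambda>k s'. same {3} {1} s s' \<and> drawn s' = drawn s \<and>
      (\<forall>u<k. reals s' 1 u = 2)"])
    fix k s' assume "same {3} {1} s s' \<and> drawn s' = drawn s \<and> (\<forall>u<k. reals s' 1 u = 2)"
      "k < n" "nats s' 3 0 = k"
    then show "steps n d \<Delta> \<omega> 1 (RSet 1 (nvar 3) (rnum 2))
       (\<lambda>s'. nats s' 3 0 = k \<and> same {3} {1} s (s'\<lparr>nats := upd (nats s') 3 0 (Suc k)\<rparr>) \<and>
         drawn (s'\<lparr>nats := upd (nats s') 3 0 (Suc k)\<rparr>) = drawn s \<and>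
         (\<forall>u<Suc k. reals (s'\<lparr>nats := upd (nats s') 3 0 (Suc k)\<rparr>) 1 u = 2)) s'"
      by (intro steps_intros; simp add: upd_def same_def less_Suc_eq)
  qed (auto simp: same_def upd_def)
  \<comment> \<open>After \<open>k\<close> centres, \<open>Suc k\<close> draws have been consumed,
    the first of them for the radius.\<close>
  let ?I = "\<lambda>k (s :: state). ?G s \<and> drawn s = Suc k \<and> reals s 2 0 = ?R \<and>
    (\<forall>u<n. reals s 1 u = best ?f ?R ?p k u \<and> nats s 0 u = label ?f ?R ?p k u)"
  have c2: "steps n d \<Delta> \<omega> (n * (1 + (n * 3 + 2 + (n * (n * 5 + 6) + 2)) + (n * 5 + 2) + 2) + 2)
     (for_loop 3 (Seq (Sample 3 (NConst 0)) (Seq find_profile claim))) (?I n) s"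
    if "?I 0 s" for s
  proof (rule steps_for_loop[where I = ?I and T = "1 + (n * 3 + 2 + (n * (n * 5 + 6) + 2)) + (n * 5 + 2)"])
    fix k s assume I: "?I k s" and k: "k < n" "nats s 3 0 = k"
    show "steps n d \<Delta> \<omega> (1 + (n * 3 + 2 + (n * (n * 5 + 6) + 2)) + (n * 5 + 2))
        (Seq (Sample 3 (NConst 0)) (Seq find_profile claim))
        (\<lambda>s. nats s 3 0 = k \<and> ?I (Suc k) (s\<lparr>nats := upd (nats s) 3 0 (Suc k)\<rparr>)) s"
    proof (rule steps_Seq_atom, simp, rule steps_Seq[OF steps_find_profile[where c = k], where ?T2.0 = "n * 5 + 2"], goal_cases)
      case (5 t)
      have "nats t 3 0 = k"
        using 5 k by (simp add: same_def)
      from steps_claim[OF this] show ?case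
      proof (rule steps_weaken)
        fix t' assume t': "same {0,5} {1} t t' \<and> drawn t' = drawn t \<and>
          (\<forall>u<n. (reals t' 1 u, nats t' 0 u) =
            (if reals t 0 u \<le> reals t 2 0 \<and> reals t 3 0 < reals t 1 u then (reals t 3 0, k)
             else (reals t 1 u, nats t 0 u)))"
        show "nats t' 3 0 = k \<and> ?I (Suc k) (t'\<lparr>nats := upd (nats t') 3 0 (Suc k)\<rparr>)"
          using t' 5 I k by (auto simp: same_def upd_def split: if_splits)
      qed simp
    qed (use I k in \<open>simp_all add: upd_def\<close>)
  next
    show "?I 0 (s\<lparr>nats := upd (nats s) 3 0 0\<rparr>)"
      using that by (simp add: upd_def)
  qed auto
  have "steps n d \<Delta> \<omega> (2 + (n * 3 + 2) +
      (n * (1 + (n * 3 + 2 + (n * (n * 5 + 6) + 2)) + (n * 5 + 2) + 2) + 2))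
     (Seq (Sample 2 (NConst 0))
     (Seq (RSet 2 (NConst 0) (RDiv (RMul RDelta (rvar 2)) (rnum 4)))
     (Seq (for_loop 3 (RSet 1 (nvar 3) (rnum 2)))
       (for_loop 3 (Seq (Sample 3 (NConst 0)) (Seq find_profile claim)))))) (?I n) s2"
  proof (rule steps_Seq_atom, simp, rule steps_Seq_atom, simp, rule steps_Seq[OF c1], rule c2, goal_cases)
    case (1 t)
    then show ?case
      using s2 by (simp add: same_def upd_def)
  qed simp
  then show ?case
    by (rule steps_weaken) auto
next
  case 5
  then show ?case by (simp add: time_bound_def)
qed (auto simp: same_def init_state_def)

section \<open>From separation probabilities to cut norms\<close>

lemma Youngs_inequality_nonneg:
  fixes a :: real
  assumes "0 \<le> \<alpha>" "0 \<le> \<beta>" "\<alpha> + \<beta> = 1" "0 \<le> a" "0 \<le> b"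
  shows "a powr \<alpha> * b powr \<beta> \<le> \<alpha> * a + \<beta> * b"
\<comment> \<open>If \<open>a\<close> or \<open>b\<close> is zero the left side vanishes, as
  \<open>0 powr x = 0\<close> for every \<open>x\<close>, even for \<open>x = 0\<close>.\<close>
proof (cases "a = 0 \<or> b = 0")
  case True
  then show ?thesis using assms by auto
next
  case False
  then show ?thesis using assms by (intro Youngs_inequality_0) auto
qed

text \<open>The power mean inequality. Young's inequality with exponents \<open>1 / q\<close> and
  \<open>1 - 1 / q\<close>, applied to each term against the mean \<open>a\<close>, is the
  tangent-line bound at \<open>a\<close>; summing it over \<open>S\<close> gives the claim.\<close>

lemma powr_sum_le:
  fixes x :: "'a \<Rightarrow> real"
  assumes "1 \<le> q" "\<And>i. i \<in> S \<Longrightarrow> 0 \<le> x i"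
  shows "(\<Sum>i\<in>S. x i) powr q \<le> real (card S) powr (q - 1) * (\<Sum>i\<in>S. x i powr q)"
\<comment> \<open>This case absorbs empty and infinite \<open>S\<close>, whose sums are 0.\<close>
proof (cases "(\<Sum>i\<in>S. x i) = 0")
  case True
  then show ?thesis by (simp add: sum_nonneg)
next
  case False
  then have "finite S" "S \<noteq> {}"
    by (auto intro: ccontr)
  then have k: "0 < real (card S)"
    by (simp add: card_gt_0_iff)
  define a where "a = (\<Sum>i\<in>S. x i) / card S"
  have sum: "(\<Sum>i\<in>S. x i) = card S * a"
    using k by (simp add: a_def)
  have a: "0 < a"
    using False k sum_nonneg[of S x] assms(2) by (simp add: a_def)
  have Young: "x i * a powr (q - 1) \<le> x i powr q / q + (1 - 1 / q) * a powr q" if "i \<in> S" for i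
  proof -
    have "(x i powr q) powr (1 / q) * (a powr q) powr (1 - 1 / q)
        \<le> 1 / q * (x i powr q) + (1 - 1 / q) * a powr q"
      using assms(1) by (intro Youngs_inequality_nonneg) auto
    moreover have "(a powr q) powr (1 - 1 / q) = a powr (q - 1)"
    proof -
      have "q * (1 - 1 / q) = q - 1"
        using assms(1) by (simp add: field_simps)
      then show ?thesis by (simp only: powr_powr)
    qed
    ultimately show ?thesis
      using assms that by (simp add: powr_powr)
  qed
  have "card S * a powr q = (\<Sum>i\<in>S. x i) * a powr (q - 1)"
    using a by (simp add: sum powr_mult_base)
  also have "\<dots> \<le> (\<Sum>i\<in>S. x i powr q / q + (1 - 1 / q) * a powr q)"
    unfolding sum_distrib_right by (intro sum_mono Young)
  also have "\<dots> = (\<Sum>i\<in>S. x i powr q) / q + card S * ((1 - 1 / q) * a powr q)"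
    by (simp add: sum.distrib sum_divide_distrib)
  finally have "(card S * a powr q) / q \<le> (\<Sum>i\<in>S. x i powr q) / q"
    by (simp add: algebra_simps)
  then have *: "card S * a powr q \<le> (\<Sum>i\<in>S. x i powr q)"
    using assms(1) by (simp add: divide_le_cancel)
  have "(\<Sum>i\<in>S. x i) powr q = real (card S) powr q * a powr q"
    using a k by (simp add: sum powr_mult)
  also have "\<dots> = real (card S) powr (q - 1) * (card S * a powr q)"
    using powr_mult_base[of "real (card S)" "q - 1"] by (simp add: mult_ac)
  also have "\<dots> \<le> real (card S) powr (q - 1) * (\<Sum>i\<in>S. x i powr q)"
    using * by (intro mult_left_mono) auto
  finally show ?thesis .
qed

text \<open>Scaling to \<open>a + b = 1\<close> reduces this to \<open>x <= x powr r\<close> on the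
  unit interval.\<close>

lemma powr_add_le:
  fixes a b r :: real
  assumes "0 \<le> a" "0 \<le> b" "0 < r" "r \<le> 1"
  shows "(a + b) powr r \<le> a powr r + b powr r"
proof (cases "a + b = 0")
  case False
  let ?c = "a + b"
  have c: "0 < ?c" using False assms by simp
  have *: "x / ?c \<le> (x / ?c) powr r" if "0 \<le> x" "x \<le> ?c" for x
  proof (cases "x = 0")
    case False
    then have "(x / ?c) powr 1 \<le> (x / ?c) powr r"
      using that assms c by (intro powr_mono') (auto simp: field_simps)
    then show ?thesis using that c by (simp add: powr_one)
  qed simp
  have "1 = a / ?c + b / ?c"
    using c by (simp flip: add_divide_distrib)
  also have "\<dots> \<le> (a / ?c) powr r + (b / ?c) powr r"
    using assms by (intro add_mono *) auto
  also have "\<dots> = (a powr r + b powr r) / ?c powr r"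
    using assms c by (simp add: powr_divide add_divide_distrib)
  finally show ?thesis
    using c by (simp add: field_simps)
qed simp

text \<open>Jensen's inequality for a concave power, again through Young's inequality as the tangent
  at the mean \<open>a\<close>. A zero mean forces \<open>Y\<close> to vanish almost
  everywhere.\<close>

lemma (in prob_space) expectation_powr_le:
  fixes Y :: "'a \<Rightarrow> real"
  assumes Y: "integrable M Y" "\<And>x. x \<in> space M \<Longrightarrow> 0 \<le> Y x" and r: "0 < r" "r \<le> 1"
  shows "expectation (\<lambda>x. Y x powr r) \<le> expectation Y powr r"
proof (cases "expectation Y = 0")
  case True
  then have "AE x in M. Y x = 0"
    using Y integral_nonneg_eq_0_iff_AE[of M Y] by auto
  then have "AE x in M. Y x powr r = 0"
    by eventually_elim simp
  then have "expectation (\<lambda>x. Y x powr r) = 0"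
    by (subst integral_cong_AE[where g = "\<lambda>_. 0"]) (use Y(1) in auto)
  then show ?thesis by simp
next
  case False
  define a where "a = expectation Y"
  have a: "0 < a"
    using False Y(2) integral_nonneg_AE[of Y M] by (simp add: a_def less_eq_real_def)
  have "a powr (1 - r) * expectation (\<lambda>x. Y x powr r) = expectation (\<lambda>x. a powr (1 - r) * Y x powr r)"
    by simp
  also have "\<dots> \<le> expectation (\<lambda>x. r * Y x + (1 - r) * a)"
  proof (rule integral_mono')
    fix x assume "x \<in> space M"
    then show "a powr (1 - r) * Y x powr r \<le> r * Y x + (1 - r) * a"
      using Youngs_inequality_nonneg[of r "1 - r" "Y x" a] Y(2) a r by (simp add: mult.commute)
  qed (use Y a r in auto)
  also have "\<dots> = a"
    using Y(1) by (simp add: a_def prob_space algebra_simps)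
  also have "\<dots> = a powr (1 - r) * a powr r"
    using a by (simp flip: powr_add)
  finally show ?thesis
    using a by (simp add: a_def)
qed

text \<open>Short cut edges are few, so the power mean inequality applies to them. For the long ones
  only \<open>q - 1\<close> of the \<open>q\<close> factors are replaced by the deterministic bound
  \<open>M * D\<close>; the remaining factor keeps the estimate linear in the separation indicators,
  so that expectations can be taken edge by edge.\<close>

lemma cut_powr_le:
  assumes X: "finite X" and G: "weighted_graph X E w" and q: "1 \<le> q" and M: "0 < M" and u: "u \<in> X"
    and \<rho>: "\<And>v. v \<in> X \<Longrightarrow> 0 \<le> \<rho> v"
    and short: "card {v \<in> X. \<rho> v \<le> 1 / real M \<and> separated \<P> u v} \<le> M"
  defines "D \<equiv> (\<Sum>v\<in>nbrs E u. w {u, v} * \<rho> v)"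
  shows "cut \<P> E w u powr q \<le> 2 powr q * real M powr (q - 1) *
    (\<Sum>v\<in>nbrs E u. (w {u, v} powr q + D powr (q - 1) * w {u, v}) * of_bool (separated \<P> u v))"
proof -
  let ?N = "nbrs E u"
  let ?S = "{v \<in> ?N. separated \<P> u v \<and> \<rho> v \<le> 1 / real M}"
  let ?L = "{v \<in> ?N. separated \<P> u v \<and> \<not> \<rho> v \<le> 1 / real M}"
  let ?s = "\<Sum>v\<in>?S. w {u, v}" and ?l = "\<Sum>v\<in>?L. w {u, v}"
  let ?a = "\<Sum>v\<in>?N. w {u, v} powr q * of_bool (separated \<P> u v)"
  let ?b = "\<Sum>v\<in>?N. w {u, v} * of_bool (separated \<P> u v)"
  have N: "?N \<subseteq> X" and w: "\<And>v. v \<in> ?N \<Longrightarrow> 0 \<le> w {u, v}"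
    using G by (auto simp: weighted_graph_def nbrs_def)
  have fin: "finite ?N"
    using N X finite_subset by blast
  have D: "0 \<le> D"
    unfolding D_def using w N \<rho> by (intro sum_nonneg mult_nonneg_nonneg) auto
  have s: "0 \<le> ?s" and l: "0 \<le> ?l"
    using w by (auto intro!: sum_nonneg)
  have restrict: "(\<Sum>v\<in>?N. f v * of_bool (separated \<P> u v)) = (\<Sum>v\<in>{v \<in> ?N. separated \<P> u v}. f v)" for f :: "'a \<Rightarrow> real"
    using fin by (intro sum.mono_neutral_cong_right) auto
  have "cut \<P> E w u = (\<Sum>v\<in>?S \<union> ?L. w {u, v})"
    unfolding cut_def restrict by (intro sum.cong) auto
  also have "\<dots> = ?s + ?l"
    using fin by (intro sum.union_disjoint) auto
  finally have cut: "cut \<P> E w u = ?s + ?l" .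
  have "?s powr q \<le> real (card ?S) powr (q - 1) * (\<Sum>v\<in>?S. w {u, v} powr q)"
    using q w by (intro powr_sum_le) auto
  also have "\<dots> \<le> real M powr (q - 1) * ?a"
  proof (intro mult_mono powr_mono2)
    have "card ?S \<le> card {v \<in> X. \<rho> v \<le> 1 / real M \<and> separated \<P> u v}"
      using N X by (intro card_mono) auto
    with short show "real (card ?S) \<le> real M" by simp
    show "(\<Sum>v\<in>?S. w {u, v} powr q) \<le> ?a"
      unfolding restrict using fin by (intro sum_mono2) auto
  qed (use q in \<open>auto intro!: sum_nonneg\<close>)
  finally have S: "?s powr q \<le> real M powr (q - 1) * ?a" .
  have lb: "?l \<le> ?b"
    unfolding restrict using fin w by (intro sum_mono2) auto
  have "?l \<le> (\<Sum>v\<in>?L. real M * (w {u, v} * \<rho> v))"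
  proof (intro sum_mono)
    fix v assume v: "v \<in> ?L"
    then have "1 \<le> real M * \<rho> v"
      using M by (simp add: field_simps)
    then have "w {u, v} * 1 \<le> w {u, v} * (real M * \<rho> v)"
      using v w by (intro mult_left_mono) auto
    then show "w {u, v} \<le> real M * (w {u, v} * \<rho> v)"
      by (simp add: algebra_simps)
  qed
  also have "\<dots> \<le> (\<Sum>v\<in>?N. real M * (w {u, v} * \<rho> v))"
    using fin w \<rho> N by (intro sum_mono2) auto
  also have "\<dots> = real M * D"
    by (simp add: D_def sum_distrib_left)
  finally have lD: "?l \<le> real M * D" .
  have "?l powr q = ?l powr (q - 1) * ?l"
    using l powr_mult_base[of ?l "q - 1"] by (simp add: mult.commute)
  also have "\<dots> \<le> (real M * D) powr (q - 1) * ?b"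
    using l lD lb q by (intro mult_mono powr_mono2) auto
  also have "\<dots> = real M powr (q - 1) * (D powr (q - 1) * ?b)"
    using D by (simp add: powr_mult)
  finally have L: "?l powr q \<le> real M powr (q - 1) * (D powr (q - 1) * ?b)" .
  have "cut \<P> E w u powr q \<le> (2 * max ?s ?l) powr q"
    unfolding cut using q s l by (intro powr_mono2) auto
  also have "\<dots> = 2 powr q * max ?s ?l powr q"
    using s by (simp add: powr_mult)
  also have "\<dots> \<le> 2 powr q * (?s powr q + ?l powr q)"
    by (intro mult_left_mono) (auto simp: max_def)
  also have "\<dots> \<le> 2 powr q * (real M powr (q - 1) * ?a + real M powr (q - 1) * (D powr (q - 1) * ?b))"
    by (intro mult_left_mono add_mono S L) auto
  also have "\<dots> = 2 powr q * real M powr (q - 1) * (?a + D powr (q - 1) * ?b)"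
    by (simp add: algebra_simps)
  also have "?a + D powr (q - 1) * ?b =
      (\<Sum>v\<in>?N. (w {u, v} powr q + D powr (q - 1) * w {u, v}) * of_bool (separated \<P> u v))"
    by (simp add: sum_distrib_left sum.distrib[symmetric] algebra_simps del: of_bool_eq)
  finally show ?thesis .
qed

text \<open>Jensen's inequality moves the expectation inside the power \<open>1 / q\<close>, and
  \<open>cut_powr_le\<close> is then integrated term by term. The long edges give
  \<open>D u powr (q - 1) * D u\<close>, hence the second sum; subadditivity of the root separates
  the two sums.\<close>

lemma (in prob_space) expected_lq_norm_cut_le:
  fixes \<P> :: "'a \<Rightarrow> 'b set set"
  assumes meas: "\<P> \<in> M \<rightarrow>\<^sub>M count_space UNIV"
    and X: "finite X" and G: "weighted_graph X E w" and q: "1 \<le> q" and m: "0 < m" and \<kappa>: "0 \<le> \<kappa>"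
    and \<rho>: "\<And>u v. u \<in> X \<Longrightarrow> v \<in> X \<Longrightarrow> 0 \<le> \<rho> u v"
    and sep: "\<And>u v. u \<in> X \<Longrightarrow> v \<in> X \<Longrightarrow> prob {\<omega> \<in> space M. separated (\<P> \<omega>) u v} \<le> \<kappa> * \<rho> u v"
    and short: "\<And>\<omega> u. \<omega> \<in> space M \<Longrightarrow> u \<in> X \<Longrightarrow>
      card {v \<in> X. \<rho> u v \<le> 1 / real m \<and> separated (\<P> \<omega>) u v} \<le> m"
  shows "expectation (\<lambda>\<omega>. lq_norm q X (cut (\<P> \<omega>) E w)) \<le>
    2 * real m powr ((q - 1) / q) * \<kappa> powr (1 / q) *
      ((\<Sum>u\<in>X. \<Sum>v\<in>nbrs E u. w {u, v} powr q * \<rho> u v) powr (1 / q) +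
       (\<Sum>u\<in>X. (\<Sum>v\<in>nbrs E u. w {u, v} * \<rho> u v) powr q) powr (1 / q))"
proof -
  define D where "D u = (\<Sum>v\<in>nbrs E u. w {u, v} * \<rho> u v)" for u
  let ?c = "\<lambda>u v. w {u, v} powr q + D u powr (q - 1) * w {u, v}"
  let ?K = "2 powr q * real m powr (q - 1)"
  let ?A = "\<Sum>u\<in>X. \<Sum>v\<in>nbrs E u. w {u, v} powr q * \<rho> u v"
  let ?B = "\<Sum>u\<in>X. D u powr q"
  define Y where "Y \<omega> = (\<Sum>u\<in>X. cut (\<P> \<omega>) E w u powr q)" for \<omega>
  have N: "\<And>u v. v \<in> nbrs E u \<Longrightarrow> v \<in> X" and w: "\<And>u v. v \<in> nbrs E u \<Longrightarrow> 0 \<le> w {u, v}"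
    using G by (auto simp: weighted_graph_def nbrs_def)
  have D: "0 \<le> D u" if "u \<in> X" for u
    unfolding D_def using w N \<rho> that by (intro sum_nonneg mult_nonneg_nonneg) auto
  have A: "0 \<le> ?A"
    using w N \<rho> by (intro sum_nonneg mult_nonneg_nonneg) auto
  have B: "0 \<le> ?B"
    by (intro sum_nonneg) auto
  \<comment> \<open>The partition is measurable into a discrete space, so every real function of it
    is measurable.\<close>
  have meas': "(\<lambda>\<omega>. g (\<P> \<omega>)) \<in> borel_measurable M" for g :: "'b set set \<Rightarrow> real"
    using meas by (rule measurable_compose) simp
  have sets: "{\<omega> \<in> space M. separated (\<P> \<omega>) u v} \<in> events" for u v
    using measurable_sets[OF meas, of "{\<P>. separated \<P> u v}"] by (simp add: vimage_def Int_def conj_commute)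
  have sepint: "integrable M (\<lambda>\<omega>. of_bool (separated (\<P> \<omega>) u v) :: real)"
    and sepexp: "expectation (\<lambda>\<omega>. of_bool (separated (\<P> \<omega>) u v)) = prob {\<omega> \<in> space M. separated (\<P> \<omega>) u v}" for u v
  proof -
    have *: "of_bool (separated (\<P> \<omega>) u v) = (indicator {\<omega> \<in> space M. separated (\<P> \<omega>) u v} \<omega> :: real)"
      if "\<omega> \<in> space M" for \<omega>
      using that by (simp add: indicator_def)
    show "integrable M (\<lambda>\<omega>. of_bool (separated (\<P> \<omega>) u v) :: real)"
      by (rule integrable_const_bound[where B = 1]) (use meas' in auto)
    show "expectation (\<lambda>\<omega>. of_bool (separated (\<P> \<omega>) u v)) = prob {\<omega> \<in> space M. separated (\<P> \<omega>) u v}"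
      by (subst Bochner_Integration.integral_cong[OF refl *]) (use sets in auto)
  qed
  have pathwise: "Y \<omega> \<le> ?K * (\<Sum>u\<in>X. \<Sum>v\<in>nbrs E u. ?c u v * of_bool (separated (\<P> \<omega>) u v))"
    if "\<omega> \<in> space M" for \<omega>
  proof -
    have "Y \<omega> \<le> (\<Sum>u\<in>X. ?K * (\<Sum>v\<in>nbrs E u. ?c u v * of_bool (separated (\<P> \<omega>) u v)))"
      unfolding Y_def D_def
      by (intro sum_mono cut_powr_le[OF X G]) (use q m \<rho> short[OF that] in auto)
    then show ?thesis
      by (simp add: sum_distrib_left)
  qed
  have int: "integrable M (\<lambda>\<omega>. ?K * (\<Sum>u\<in>X. \<Sum>v\<in>nbrs E u. ?c u v * of_bool (separated (\<P> \<omega>) u v)))"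
    using sepint by (intro integrable_mult_right Bochner_Integration.integrable_sum)
  have Y0: "0 \<le> Y \<omega>" for \<omega>
    unfolding Y_def by (intro sum_nonneg) auto
  have "Y \<in> borel_measurable M"
    unfolding Y_def by (rule meas'[of "\<lambda>\<Q>. \<Sum>u\<in>X. cut \<Q> E w u powr q"])
  \<comment> \<open>Integrability comes from domination by the pathwise bound.\<close>
  then have Yint: "integrable M Y"
    by (rule Bochner_Integration.integrable_bound[OF int])
      (use pathwise Y0 in \<open>auto intro!: AE_I2 order_trans[OF _ abs_ge_self]\<close>)
  have "expectation Y \<le> expectation (\<lambda>\<omega>. ?K * (\<Sum>u\<in>X. \<Sum>v\<in>nbrs E u. ?c u v * of_bool (separated (\<P> \<omega>) u v)))"
    by (intro integral_mono Yint int pathwise)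
  also have "\<dots> = ?K * (\<Sum>u\<in>X. \<Sum>v\<in>nbrs E u. ?c u v * prob {\<omega> \<in> space M. separated (\<P> \<omega>) u v})"
    using sepint by (simp add: sepexp Bochner_Integration.integral_sum)
  also have "\<dots> \<le> ?K * (\<Sum>u\<in>X. \<Sum>v\<in>nbrs E u. ?c u v * (\<kappa> * \<rho> u v))"
    using sep N w by (intro mult_left_mono sum_mono add_nonneg_nonneg mult_nonneg_nonneg) auto
  also have "(\<Sum>u\<in>X. \<Sum>v\<in>nbrs E u. ?c u v * (\<kappa> * \<rho> u v)) =
      \<kappa> * (?A + (\<Sum>u\<in>X. D u powr (q - 1) * D u))"
  proof -
    have "(\<Sum>v\<in>nbrs E u. (w {u, v} powr q + x * w {u, v}) * (\<kappa> * \<rho> u v)) =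
        \<kappa> * ((\<Sum>v\<in>nbrs E u. w {u, v} powr q * \<rho> u v) + x * (\<Sum>v\<in>nbrs E u. w {u, v} * \<rho> u v))" for u x
      by (simp add: sum_distrib_left sum.distrib algebra_simps)
    then have "(\<Sum>v\<in>nbrs E u. ?c u v * (\<kappa> * \<rho> u v)) =
        \<kappa> * ((\<Sum>v\<in>nbrs E u. w {u, v} powr q * \<rho> u v) + D u powr (q - 1) * D u)" for u
      by (simp only: flip: D_def)
    then show ?thesis
      by (simp add: sum_distrib_left[symmetric] sum.distrib)
  qed
  also have "(\<Sum>u\<in>X. D u powr (q - 1) * D u) = ?B"
    using D powr_mult_base[of "D _" "q - 1"] by (intro sum.cong) (auto simp: mult.commute)
  finally have EY: "expectation Y \<le> ?K * (\<kappa> * (?A + ?B))" .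
  have "expectation (\<lambda>\<omega>. lq_norm q X (cut (\<P> \<omega>) E w)) = expectation (\<lambda>\<omega>. Y \<omega> powr (1 / q))"
    by (simp add: lq_norm_def Y_def)
  also have "\<dots> \<le> expectation Y powr (1 / q)"
    using Yint Y0 q by (intro expectation_powr_le) auto
  also have "\<dots> \<le> (?K * (\<kappa> * (?A + ?B))) powr (1 / q)"
    using EY Y0 q by (intro powr_mono2) (auto intro!: integral_nonneg)
  also have "\<dots> = 2 * real m powr ((q - 1) / q) * \<kappa> powr (1 / q) * (?A + ?B) powr (1 / q)"
    using q \<kappa> A B by (simp add: powr_mult powr_powr)
  also have "\<dots> \<le> 2 * real m powr ((q - 1) / q) * \<kappa> powr (1 / q) * (?A powr (1 / q) + ?B powr (1 / q))"
    using q A B by (intro mult_left_mono powr_add_le) auto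
  finally show ?thesis
    unfolding D_def .
qed

section \<open>Geometry of the partition\<close>

lemma squeeze_lipschitz: "0 \<le> r \<Longrightarrow> \<bar>squeeze lo r x - squeeze lo r y\<bar> \<le> \<bar>x - y\<bar>"
  by (auto simp: squeeze_def)

lemma squeeze_le: "0 \<le> r \<Longrightarrow> squeeze lo r x \<le> x"
  and squeeze_ge: "0 \<le> r \<Longrightarrow> x - r \<le> squeeze lo r x"
  by (auto simp: squeeze_def)

lemma squeeze_collapse: "lo \<le> x \<Longrightarrow> x \<le> lo + r \<Longrightarrow> squeeze lo r x = lo"
  by (auto simp: squeeze_def)

section \<open>The net of heavy points and the collapsed distance functions\<close>

locale decomposition = Metric_space "{..<n}" d for n :: nat and d :: "nat \<Rightarrow> nat \<Rightarrow> real" +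
  fixes \<Delta> :: real
  assumes \<Delta>_pos: "0 < \<Delta>"
begin

lemma scale_pos: "0 < n \<Longrightarrow> 0 < scale n"
  using scale_sq[of n] by (cases "scale n") auto

lemma net_heavy: "g \<in> net n d \<Delta> k \<Longrightarrow> scale n < card (near n d \<Delta> g)"
  by (induction k) (auto split: if_splits)

lemma net_apart:
  "g \<in> net n d \<Delta> k \<Longrightarrow> h \<in> net n d \<Delta> k \<Longrightarrow> g \<noteq> h \<Longrightarrow> 2 * \<Delta> < real (scale n) * d g h"
  by (induction k) (auto simp: commute split: if_splits)

lemma net_mono: "k \<le> m \<Longrightarrow> net n d \<Delta> k \<subseteq> net n d \<Delta> m"
  by (induction m rule: dec_induct) auto

text \<open>Maximality of the greedy choice: a heavy point rejected in its own turn was too close to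
  an earlier net point, and net points are never removed.\<close>

lemma net_dense:
  assumes "u < n" "scale n < card (near n d \<Delta> u)"
  obtains g where "g \<in> net n d \<Delta> n" "real (scale n) * d u g \<le> 2 * \<Delta>"
proof (cases "u \<in> net n d \<Delta> (Suc u)")
  case True
  then have "u \<in> net n d \<Delta> n"
    using net_mono[of "Suc u" n] assms by auto
  then show ?thesis
    using that \<Delta>_pos assms by (auto simp: mdist_zero)
next
  case False
  then obtain g where "g \<in> net n d \<Delta> u" "real (scale n) * d u g \<le> 2 * \<Delta>"
    using assms(2) by (auto split: if_splits)
  then show ?thesis
    using that net_mono[of u n] assms(1) by auto
qed

lemma finite_net: "finite (net n d \<Delta> k)"
  by (rule finite_subset[OF net_subset]) simp

text \<open>A packing bound: net points are more than \<open>2 * \<Delta> / scale n\<close> apart,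
  so their balls are disjoint, and each ball holds more than \<open>scale n\<close> of the
  \<open>n\<close> points.\<close>

lemma card_net: "card (net n d \<Delta> n) * scale n \<le> n"
proof -
  have "card (net n d \<Delta> n) * scale n = (\<Sum>g\<in>net n d \<Delta> n. scale n)"
    by simp
  also have "\<dots> \<le> (\<Sum>g\<in>net n d \<Delta> n. card (near n d \<Delta> g))"
    using net_heavy by (intro sum_mono less_imp_le)
  also have "\<dots> = card (\<Union>g\<in>net n d \<Delta> n. near n d \<Delta> g)"
  proof (rule card_UN_disjoint[symmetric])
    show "\<forall>g\<in>net n d \<Delta> n. \<forall>h\<in>net n d \<Delta> n. g \<noteq> h \<longrightarrow> near n d \<Delta> g \<inter> near n d \<Delta> h = {}"
    proof (intro ballI impI, rule ccontr)
      fix g h assume gh: "g \<in> net n d \<Delta> n" "h \<in> net n d \<Delta> n" "g \<noteq> h"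
        and "near n d \<Delta> g \<inter> near n d \<Delta> h \<noteq> {}"
      then obtain v where v: "v < n" "real (scale n) * d g v \<le> \<Delta>" "real (scale n) * d h v \<le> \<Delta>"
        by (auto simp: near_def)
      have "g < n" "h < n"
        using gh(1,2)[THEN subsetD[OF net_subset]] by auto
      then have "d g h \<le> d g v + d h v"
        using triangle[of g v h] v(1) by (simp add: commute)
      then have "real (scale n) * d g h \<le> real (scale n) * (d g v + d h v)"
        by (rule mult_left_mono) simp
      with v net_apart[OF gh] show False
        by (simp add: distrib_left)
    qed
  qed (auto simp: finite_net near_def)
  also have "\<dots> \<le> card {..<n}"
    by (intro card_mono) (auto simp: near_def)
  finally show ?thesis by simp
qed

text \<open>The triangle inequality gives the bound for \<open>d c\<close>, and each squeeze
  preserves it.\<close>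

lemma profile_lipschitz:
  assumes "c < n" "u < n" "v < n"
  shows "\<bar>profile n d \<Delta> c k u - profile n d \<Delta> c k v\<bar> \<le> d u v"
proof (induction k)
  case 0
  then show ?case
    using assms triangle[of c u v] triangle[of c v u] by (simp add: commute abs_le_iff)
next
  case (Suc k)
  have "0 \<le> 6 * \<Delta> / real (scale n)"
    using \<Delta>_pos by simp
  with Suc show ?case
    by (auto intro: order_trans[OF squeeze_lipschitz])
qed

lemma profile_le: "profile n d \<Delta> c k u \<le> d c u"
proof (induction k)
  case (Suc k)
  have "0 \<le> 6 * \<Delta> / real (scale n)"
    using \<Delta>_pos by simp
  with Suc show ?case
    by (auto intro: order_trans[OF squeeze_le])
qed simp

text \<open>A squeeze lowers a value by at most the length of its interval, and only stages in the
  net squeeze.\<close>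

lemma profile_ge_aux:
  "d c u - real (card (net n d \<Delta> n \<inter> {..<k})) * (6 * \<Delta> / real (scale n)) \<le> profile n d \<Delta> c k u"
proof (induction k)
  case (Suc k)
  have r: "0 \<le> 6 * \<Delta> / real (scale n)"
    using \<Delta>_pos by simp
  have "net n d \<Delta> n \<inter> {..<Suc k} =
      (if k \<in> net n d \<Delta> n then insert k (net n d \<Delta> n \<inter> {..<k}) else net n d \<Delta> n \<inter> {..<k})"
    by (auto simp: less_Suc_eq)
  then have c: "real (card (net n d \<Delta> n \<inter> {..<Suc k})) =
      (if k \<in> net n d \<Delta> n then 1 + real (card (net n d \<Delta> n \<inter> {..<k}))
       else real (card (net n d \<Delta> n \<inter> {..<k})))"
    by simp
  show ?case
  proof (cases "k \<in> net n d \<Delta> n")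
    case True
    have "d c u - real (card (net n d \<Delta> n \<inter> {..<Suc k})) * (6 * \<Delta> / real (scale n)) \<le>
        profile n d \<Delta> c k u - 6 * \<Delta> / real (scale n)"
      using Suc unfolding c by (simp only: True if_True distrib_right)
    also have "\<dots> \<le> profile n d \<Delta> c (Suc k) u"
      using True squeeze_ge[OF r] by simp
    finally show ?thesis .
  qed (use Suc c in simp)
qed simp

lemma profile_ge: "d c u - \<Delta> / 4 \<le> profile n d \<Delta> c n u"
proof (cases "n = 0")
  case True
  then show ?thesis using \<Delta>_pos by simp
next
  case False
  let ?M = "real (scale n)" and ?N = "real (card (net n d \<Delta> n))"
  have M: "0 < ?M"
    using False scale_pos by simp
  have "net n d \<Delta> n \<inter> {..<n} = net n d \<Delta> n"
    using net_subset by blast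
  then have "d c u - ?N * (6 * \<Delta> / ?M) \<le> profile n d \<Delta> c n u"
    using profile_ge_aux[of c u n] by simp
  \<comment> \<open>The packing bound and the choice of \<open>scale\<close> give
    \<open>24 * ?N * ?M <= 24 * n <= ?M * ?M\<close>; a factor \<open>?M\<close> cancels.\<close>
  moreover have "?N * (6 * \<Delta> / ?M) \<le> \<Delta> / 4"
  proof -
    have "24 * (?N * ?M) \<le> 24 * real n"
      using card_net by (simp flip: of_nat_mult)
    also have "\<dots> \<le> ?M * ?M"
      using scale_sq[of n] by (metis of_nat_le_iff of_nat_mult of_nat_numeral)
    finally have "24 * ?N \<le> ?M"
      using M by (simp add: mult.assoc[symmetric] del: mult.assoc)
    then have "24 * ?N * \<Delta> \<le> ?M * \<Delta>"
      using \<Delta>_pos by (intro mult_right_mono) auto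
    then show ?thesis
      using M by (simp add: field_simps)
  qed
  ultimately show ?thesis by linarith
qed

text \<open>At stage \<open>g\<close> the Lipschitz bound puts both values in the interval centred
  at the value of \<open>g\<close>, so both are sent to its lower end. Later stages apply one and
  the same map to equal values.\<close>

lemma profile_collapse:
  assumes "c < n" "u < n" "v < n" "g \<in> net n d \<Delta> n" "g < k"
    and "real (scale n) * d u g \<le> 3 * \<Delta>" "real (scale n) * d v g \<le> 3 * \<Delta>"
  shows "profile n d \<Delta> c k u = profile n d \<Delta> c k v"
proof -
  have M: "0 < real (scale n)"
    using scale_pos assms by simp
  have g: "g < n"
    using assms(4) net_subset by blast
  have "profile n d \<Delta> c (Suc g) w = profile n d \<Delta> c g g - 3 * \<Delta> / real (scale n)"
    if w: "w < n" "real (scale n) * d w g \<le> 3 * \<Delta>" for w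
  proof -
    have "\<bar>profile n d \<Delta> c g w - profile n d \<Delta> c g g\<bar> \<le> d w g"
      using profile_lipschitz assms(1) w(1) g by simp
    also have "\<dots> \<le> 3 * \<Delta> / real (scale n)"
      using w M by (simp add: field_simps)
    finally show ?thesis
      using assms(4) by (simp add: squeeze_collapse abs_le_iff)
  qed
  then have base: "profile n d \<Delta> c (Suc g) u = profile n d \<Delta> c (Suc g) v"
    using assms by simp
  have "Suc g \<le> k" using assms by simp
  then show ?thesis
  proof (rule dec_induct)
    fix m
    assume "profile n d \<Delta> c m u = profile n d \<Delta> c m v"
    then show "profile n d \<Delta> c (Suc m) u = profile n d \<Delta> c (Suc m) v" by simp
  qed (fact base)
qed

text \<open>A heavy \<open>u\<close> is within \<open>2 * \<Delta> / scale n\<close> of a net point,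
  and \<open>v\<close> is at most \<open>\<Delta> / scale n\<close> farther away. This is why the
  intervals have half-length \<open>3 * \<Delta> / scale n\<close>.\<close>

lemma profile_near_heavy:
  assumes "c < n" "u < n" "scale n < card (near n d \<Delta> u)" "v \<in> near n d \<Delta> u"
  shows "profile n d \<Delta> c n u = profile n d \<Delta> c n v"
proof -
  obtain g where g: "g \<in> net n d \<Delta> n" "real (scale n) * d u g \<le> 2 * \<Delta>"
    using net_dense assms by blast
  have v: "v < n" "real (scale n) * d u v \<le> \<Delta>"
    using assms(4) by (auto simp: near_def)
  have gn: "g < n"
    using g(1) net_subset by blast
  have "d v g \<le> d u v + d u g"
    using triangle[of v u g] v(1) gn assms(2) by (simp add: commute)
  then have "real (scale n) * d v g \<le> real (scale n) * (d u v + d u g)"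
    by (rule mult_left_mono) simp
  also have "\<dots> \<le> 3 * \<Delta>"
    using g v by (simp add: distrib_left)
  finally show ?thesis
    using assms v g gn \<Delta>_pos by (intro profile_collapse[where g = g]) auto
qed

end

text \<open>The chosen centre is the lexicographic minimum of priority and index among those that
  reach \<open>u\<close>. Priorities below 2 ensure that the first such centre replaces the initial
  value.\<close>

lemma best_label:
  assumes "\<And>c. c < k \<Longrightarrow> p c < 2"
  shows "if \<exists>c<k. f c u \<le> R
    then label f R p k u < k \<and> f (label f R p k u) u \<le> R \<and> best f R p k u = p (label f R p k u) \<and>
      (\<forall>c<k. f c u \<le> R \<longrightarrow> p (label f R p k u) < p c \<or>
         p (label f R p k u) = p c \<and> label f R p k u \<le> c)
    else best f R p k u = 2"
  using assms
proof (induction k)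
  case (Suc k)
  then have IH: "if \<exists>c<k. f c u \<le> R
    then label f R p k u < k \<and> f (label f R p k u) u \<le> R \<and> best f R p k u = p (label f R p k u) \<and>
      (\<forall>c<k. f c u \<le> R \<longrightarrow> p (label f R p k u) < p c \<or>
         p (label f R p k u) = p c \<and> label f R p k u \<le> c)
    else best f R p k u = 2" and "p k < 2"
    by auto
  show ?case
  proof (cases "\<exists>c<k. f c u \<le> R")
    case True
    with IH show ?thesis
      by (auto simp: less_Suc_eq; fastforce)
  next
    case False
    with IH \<open>p k < 2\<close> show ?thesis
      by (auto simp: less_Suc_eq)
  qed
qed simp

lemma label_cong:
  assumes "\<And>c. c < k \<Longrightarrow> f c u = f c v"
  shows "label f R p k u = label f R p k v"
proof -
  \<comment> \<open>The update of \<open>label\<close> tests \<open>best\<close>, so both are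
    carried through the induction.\<close>
  have "label f R p k u = label f R p k v \<and> best f R p k u = best f R p k v"
    using assms by (induction k) auto
  then show ?thesis ..
qed

text \<open>The Calinescu-Karloff-Rabani argument. Let \<open>c\<close> be the lexicographically
  first of the two chosen centres. If it reached both points, both would choose it; so it reaches
  exactly one, and \<open>R\<close> falls between its two values. No centre that reaches either
  point has smaller priority.\<close>

lemma label_separated:
  assumes p: "\<And>c. c < n \<Longrightarrow> p c < 2"
    and claimed: "\<exists>c<n. f c u \<le> R" "\<exists>c<n. f c v \<le> R"
    and neq: "label f R p n u \<noteq> label f R p n v"
  obtains c where "c < n" "min (f c u) (f c v) \<le> R" "R < max (f c u) (f c v)"
    "\<And>c'. c' < n \<Longrightarrow> min (f c' u) (f c' v) \<le> min (f c u) (f c v) \<Longrightarrow> p c \<le> p c'"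
proof -
  let ?a = "label f R p n u" and ?b = "label f R p n v"
  have a: "?a < n" "f ?a u \<le> R" "\<And>c. c < n \<Longrightarrow> f c u \<le> R \<Longrightarrow> p ?a < p c \<or> p ?a = p c \<and> ?a \<le> c"
    using best_label[of n p f u R] p claimed(1) by auto
  have b: "?b < n" "f ?b v \<le> R" "\<And>c. c < n \<Longrightarrow> f c v \<le> R \<Longrightarrow> p ?b < p c \<or> p ?b = p c \<and> ?b \<le> c"
    using best_label[of n p f v R] p claimed(2) by auto
  consider "p ?a < p ?b \<or> p ?a = p ?b \<and> ?a < ?b" | "p ?b < p ?a \<or> p ?b = p ?a \<and> ?b < ?a"
    using neq by linarith
  then show ?thesis
  proof cases
    case 1
    then have "\<not> f ?a v \<le> R"
      using b(3)[of ?a] a(1) by auto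
    moreover have "p ?a \<le> p c'" if "c' < n" "f c' u \<le> R \<or> f c' v \<le> R" for c'
      using that a(3)[of c'] b(3)[of c'] 1 by force
    ultimately show ?thesis
      using a by (intro that[of ?a]) (force simp: min_def max_def split: if_splits)+
  next
    case 2
    then have "\<not> f ?b u \<le> R"
      using a(3)[of ?b] b(1) by auto
    moreover have "p ?b \<le> p c'" if "c' < n" "f c' u \<le> R \<or> f c' v \<le> R" for c'
      using that a(3)[of c'] b(3)[of c'] 2 by force
    ultimately show ?thesis
      using b by (intro that[of ?b]) (force simp: min_def max_def split: if_splits)+
  qed
qed

lemma partition_on_partition_of_labels: "partition_on {..<n} (partition_of_labels n l)"
  by (auto simp: partition_on_def partition_of_labels_def disjoint_def)

lemma separated_partition_of_labels:
  "u < n \<Longrightarrow> v < n \<Longrightarrow> separated (partition_of_labels n l) u v \<longleftrightarrow> l u \<noteq> l v"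
  by (auto simp: separated_def partition_of_labels_def; blast)

lemma partition_of_labels_cong:
  "(\<And>u. u < n \<Longrightarrow> l u = l' u) \<Longrightarrow> partition_of_labels n l = partition_of_labels n l'"
  unfolding partition_of_labels_def by (intro image_cong refl) auto

section \<open>Diameter, number of short cut edges, and the event of separation\<close>

context decomposition
begin

definition labels :: "(nat \<Rightarrow> real) \<Rightarrow> nat \<Rightarrow> nat" where
  "labels \<omega> = label (\<lambda>c. profile n d \<Delta> c n) (\<Delta> * \<omega> 0 / 4) (\<lambda>c. \<omega> (Suc c)) n"

text \<open>Every point is reached by itself as a centre, since its own profile there is at most
  \<open>d u u = 0\<close>.\<close>

lemma claimed:
  assumes "\<omega> \<in> space tape" "u < n"
  shows "\<exists>c<n. profile n d \<Delta> c n u \<le> \<Delta> * \<omega> 0 / 4"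
proof (intro exI conjI)
  have "profile n d \<Delta> u n u \<le> 0"
    using profile_le[of u n u] assms(2) by (simp add: mdist_zero)
  also have "0 \<le> \<Delta> * \<omega> 0 / 4"
    using assms(1) \<Delta>_pos by (simp add: space_tape)
  finally show "profile n d \<Delta> u n u \<le> \<Delta> * \<omega> 0 / 4" .
qed fact

lemma tape_less_2: "\<omega> \<in> space tape \<Longrightarrow> \<omega> i < 2"
  by (auto simp: space_tape intro: le_less_trans[of _ 1])

text \<open>The radius contributes \<open>\<Delta> / 4\<close> and the loss by collapsing another
  \<open>\<Delta> / 4\<close>.\<close>

lemma labels_dist:
  assumes \<omega>: "\<omega> \<in> space tape" and u: "u < n"
  shows "labels \<omega> u < n" "d (labels \<omega> u) u \<le> \<Delta> / 2"
proof -
  have *: "labels \<omega> u < n \<and> profile n d \<Delta> (labels \<omega> u) n u \<le> \<Delta> * \<omega> 0 / 4"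
    using best_label[of n "\<lambda>c. \<omega> (Suc c)" "\<lambda>c. profile n d \<Delta> c n" u "\<Delta> * \<omega> 0 / 4"]
      claimed[OF \<omega> u] tape_less_2[OF \<omega>] by (simp add: labels_def)
  then show "labels \<omega> u < n" ..
  have "\<Delta> * \<omega> 0 / 4 \<le> \<Delta> / 4"
    using \<omega> \<Delta>_pos by (simp add: space_tape mult_left_le)
  with * profile_ge[of "labels \<omega> u" u] show "d (labels \<omega> u) u \<le> \<Delta> / 2"
    by linarith
qed

lemma diam_labels:
  assumes \<omega>: "\<omega> \<in> space tape" and P: "P \<in> partition_of_labels n (labels \<omega>)"
  shows "diam d P \<le> \<Delta>"
proof (cases "P = {}")
  case False
  have "d x y \<le> \<Delta>" if "x \<in> P" "y \<in> P" for x y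
  proof -
    have xy: "x < n" "y < n" "labels \<omega> x = labels \<omega> y"
      using P that by (auto simp: partition_of_labels_def)
    have "d x y \<le> d (labels \<omega> x) x + d (labels \<omega> y) y"
      using triangle[of x "labels \<omega> x" y] xy labels_dist(1)[OF \<omega> xy(1)] by (simp add: commute)
    also have "\<dots> \<le> \<Delta>"
      using labels_dist(2)[OF \<omega> xy(1)] labels_dist(2)[OF \<omega> xy(2)] by simp
    finally show ?thesis .
  qed
  with False show ?thesis
    by (auto simp: diam_def intro!: cSUP_least)
qed (use \<Delta>_pos in \<open>simp add: diam_def\<close>)

text \<open>If \<open>u\<close> is heavy, all profiles agree on its ball and nothing in the ball is
  separated from \<open>u\<close>; otherwise the ball itself has at most \<open>scale n\<close>
  points.\<close>

lemma card_short_separated: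
  assumes "u < n"
  shows "card {v \<in> {..<n}. d u v / \<Delta> \<le> 1 / real (scale n) \<and>
    separated (partition_of_labels n (labels \<omega>)) u v} \<le> scale n" (is "card ?S \<le> _")
proof -
  have "0 < real (scale n)"
    using assms scale_pos by simp
  then have *: "?S = {v \<in> near n d \<Delta> u. labels \<omega> u \<noteq> labels \<omega> v}"
    using assms \<Delta>_pos by (auto simp: near_def separated_partition_of_labels field_simps)
  show ?thesis
  proof (cases "scale n < card (near n d \<Delta> u)")
    case True
    then have "labels \<omega> u = labels \<omega> v" if "v \<in> near n d \<Delta> u" for v
      unfolding labels_def using profile_near_heavy assms that by (intro label_cong) blast
    then have "{v \<in> near n d \<Delta> u. labels \<omega> u \<noteq> labels \<omega> v} = {}"
      by blast
    then show ?thesis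
      unfolding * by (simp only: card.empty)
  next
    case False
    have "card ?S \<le> card (near n d \<Delta> u)"
      unfolding * by (intro card_mono) (auto simp: near_def)
    with False show ?thesis by simp
  qed
qed

text \<open>The Lipschitz bound turns the gap between the two values of the profile into a window of
  length \<open>d u v\<close> for the radius.\<close>

lemma labels_separated:
  assumes \<omega>: "\<omega> \<in> space tape" and uv: "u < n" "v < n" "labels \<omega> u \<noteq> labels \<omega> v"
  obtains c where "c < n"
    "min (profile n d \<Delta> c n u) (profile n d \<Delta> c n v) \<le> \<Delta> * \<omega> 0 / 4"
    "\<Delta> * \<omega> 0 / 4 \<le> min (profile n d \<Delta> c n u) (profile n d \<Delta> c n v) + d u v"
    "\<And>c'. c' < n \<Longrightarrow> min (profile n d \<Delta> c' n u) (profile n d \<Delta> c' n v)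
        \<le> min (profile n d \<Delta> c n u) (profile n d \<Delta> c n v) \<Longrightarrow> \<omega> (Suc c) \<le> \<omega> (Suc c')"
proof (rule label_separated)
  show "label (\<lambda>c. profile n d \<Delta> c n) (\<Delta> * \<omega> 0 / 4) (\<lambda>c. \<omega> (Suc c)) n u
      \<noteq> label (\<lambda>c. profile n d \<Delta> c n) (\<Delta> * \<omega> 0 / 4) (\<lambda>c. \<omega> (Suc c)) n v"
    using uv(3) by (simp add: labels_def)
next
  fix c
  assume c: "c < n" "min (profile n d \<Delta> c n u) (profile n d \<Delta> c n v) \<le> \<Delta> * \<omega> 0 / 4"
    "\<Delta> * \<omega> 0 / 4 < max (profile n d \<Delta> c n u) (profile n d \<Delta> c n v)"
    "\<And>c'. c' < n \<Longrightarrow> min (profile n d \<Delta> c' n u) (profile n d \<Delta> c' n v)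
        \<le> min (profile n d \<Delta> c n u) (profile n d \<Delta> c n v) \<Longrightarrow> \<omega> (Suc c) \<le> \<omega> (Suc c')"
  have "max (profile n d \<Delta> c n u) (profile n d \<Delta> c n v)
      \<le> min (profile n d \<Delta> c n u) (profile n d \<Delta> c n v) + d u v"
    using profile_lipschitz[OF c(1) uv(1,2), of n] by (auto simp: max_def min_def)
  with c that show thesis by force
qed (use claimed[OF \<omega>] uv tape_less_2[OF \<omega>] in auto)

end

section \<open>Separation probability\<close>

abbreviation uniform01 :: "real measure" where
  "uniform01 \<equiv> restrict_space lborel {0..1}"

lemma prob_space_uniform01: "prob_space uniform01"
  by (rule prob_space_restrict_space) auto

interpretation tape: prob_space tape
  by (rule prob_space_tape)

lemma measurable_tape_component [measurable]: "(\<lambda>\<omega>. \<omega> i) \<in> borel_measurable tape"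
proof -
  have "(\<lambda>\<omega>. \<omega> i) \<in> tape \<rightarrow>\<^sub>M uniform01"
    unfolding tape_def by (rule measurable_component_singleton) simp
  moreover have "(\<lambda>x. x) \<in> uniform01 \<rightarrow>\<^sub>M borel"
    by (rule measurable_restrict_space1) simp
  ultimately show ?thesis
    by (rule measurable_compose)
qed

lemma pred_tape_le [measurable]: "Measurable.pred tape (\<lambda>\<omega>. \<omega> i \<le> \<omega> j)"
  unfolding pred_def by (intro borel_measurable_le measurable_tape_component)

lemma emeasure_uniform01_le:
  assumes "a \<le> b"
  shows "emeasure uniform01 ({a..b} \<inter> {0..1}) \<le> ennreal (b - a)"
proof -
  have "emeasure uniform01 ({a..b} \<inter> {0..1}) = emeasure lborel ({a..b} \<inter> {0..1})"
    by (rule emeasure_restrict_space) auto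
  also have "\<dots> \<le> emeasure lborel {a..b}"
    by (rule emeasure_mono) auto
  finally show ?thesis
    using assms by simp
qed

text \<open>Only an inequality, because the interval may stick out of the unit interval.\<close>

lemma tape_rectangle:
  assumes "finite J" "a \<le> b"
  shows "tape.prob {\<omega> \<in> space tape. \<forall>i\<in>J. a \<le> \<omega> i \<and> \<omega> i \<le> b} \<le> (b - a) ^ card J"
proof -
  interpret product_prob_space "\<lambda>_. uniform01" UNIV
    by (intro product_prob_spaceI prob_space_uniform01)
  let ?I = "{a..b} \<inter> {0..1}"
  have I: "?I \<in> sets uniform01"
    by (auto simp: sets_restrict_space)
  have eq: "{\<omega> \<in> space tape. \<forall>i\<in>J. a \<le> \<omega> i \<and> \<omega> i \<le> b} = {\<omega> \<in> space tape. \<forall>i\<in>J. \<omega> i \<in> ?I}"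
    by (auto simp: space_tape)
  have "emeasure tape {\<omega> \<in> space tape. \<forall>i\<in>J. a \<le> \<omega> i \<and> \<omega> i \<le> b} = (\<Prod>i\<in>J. emeasure uniform01 ?I)"
    unfolding eq unfolding tape_def using assms(1) I by (intro emeasure_PiM_Collect) auto
  also have "\<dots> = ennreal (measure uniform01 ?I ^ card J)"
    by (simp add: M.emeasure_eq_measure ennreal_power del: Int_atLeastAtMost)
  finally have "tape.prob {\<omega> \<in> space tape. \<forall>i\<in>J. a \<le> \<omega> i \<and> \<omega> i \<le> b} = measure uniform01 ?I ^ card J"
    by (simp add: tape.emeasure_eq_measure)
  also have "\<dots> \<le> (b - a) ^ card J"
    using emeasure_uniform01_le[OF assms(2)] assms(2)
    by (intro power_mono) (auto simp: M.emeasure_eq_measure simp del: Int_atLeastAtMost)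
  finally show ?thesis .
qed

lemma tape_interval:
  assumes "a \<le> b"
  shows "tape.prob {\<omega> \<in> space tape. a \<le> \<omega> i \<and> \<omega> i \<le> b} \<le> b - a"
  using tape_rectangle[of "{i}" a b] assms by simp

text \<open>The diagonal is covered by \<open>Suc N + 1\<close> squares of side
  \<open>1 / Suc N\<close>, of total measure at most \<open>2 / Suc N\<close>, for every
  \<open>N\<close>.\<close>

lemma tape_no_ties:
  assumes "i \<noteq> j"
  shows "tape.prob {\<omega> \<in> space tape. \<omega> i = \<omega> j} = 0"
proof -
  have le: "tape.prob {\<omega> \<in> space tape. \<omega> i = \<omega> j} \<le> 2 / real (Suc N)" for N
  proof -
    let ?N = "real (Suc N)"
    let ?B = "\<lambda>k. {\<omega> \<in> space tape. \<forall>l\<in>{i, j}. real k / ?N \<le> \<omega> l \<and> \<omega> l \<le> (real k + 1) / ?N}"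
    \<comment> \<open>The floor reaches \<open>Suc N\<close> when \<open>x = 1\<close>, hence the
      additional last bin.\<close>
    have bin: "\<exists>k\<le>Suc N. real k / ?N \<le> x \<and> x \<le> (real k + 1) / ?N" if x: "0 \<le> x" "x \<le> 1" for x :: real
    proof (intro exI conjI)
      let ?k = "nat \<lfloor>x * ?N\<rfloor>"
      have k: "real ?k = of_int \<lfloor>x * ?N\<rfloor>"
        using x by simp
      show "real ?k / ?N \<le> x" "x \<le> (real ?k + 1) / ?N"
        unfolding k by (simp_all add: field_simps del: of_nat_Suc) linarith+
      have "x * ?N \<le> ?N"
        using x mult_right_mono[of x 1 ?N] by simp
      then have "\<lfloor>x * ?N\<rfloor> \<le> int (Suc N)"
        unfolding floor_le_iff of_int_of_nat_eq by linarith
      then show "?k \<le> Suc N" by simp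
    qed
    have "{\<omega> \<in> space tape. \<omega> i = \<omega> j} \<subseteq> (\<Union>k\<in>{..Suc N}. ?B k)"
    proof
      fix \<omega> assume "\<omega> \<in> {\<omega> \<in> space tape. \<omega> i = \<omega> j}"
      then have \<omega>: "\<omega> \<in> space tape" "\<omega> i = \<omega> j" by auto
      then obtain k where k: "k \<le> Suc N" "real k / ?N \<le> \<omega> i" "\<omega> i \<le> (real k + 1) / ?N"
        using bin[of "\<omega> i"] by (auto simp: space_tape simp del: of_nat_Suc)
      then have "\<omega> \<in> ?B k"
        using \<omega> by (simp del: of_nat_Suc)
      with k(1) show "\<omega> \<in> (\<Union>k\<in>{..Suc N}. ?B k)" by blast
    qed
    then have "tape.prob {\<omega> \<in> space tape. \<omega> i = \<omega> j} \<le> tape.prob (\<Union>k\<in>{..Suc N}. ?B k)"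
      by (intro tape.finite_measure_mono) measurable
    also have "\<dots> \<le> (\<Sum>k\<in>{..Suc N}. tape.prob (?B k))"
      by (intro tape.finite_measure_subadditive_finite) auto
    also have "\<dots> \<le> (\<Sum>k\<in>{..Suc N}. (1 / ?N) ^ 2)"
    proof (intro sum_mono)
      fix k
      have "(real k + 1) / ?N - real k / ?N = 1 / ?N"
        by (simp flip: diff_divide_distrib)
      then show "tape.prob (?B k) \<le> (1 / ?N) ^ 2"
        using tape_rectangle[of "{i, j}" "real k / ?N" "(real k + 1) / ?N"] assms
        by (simp add: divide_right_mono power2_eq_square)
    qed
    also have "\<dots> = (?N + 1) / ?N ^ 2"
      by (simp add: power_divide)
    also have "\<dots> \<le> (2 * ?N) / ?N ^ 2"
      by (intro divide_right_mono) auto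
    also have "\<dots> = 2 / ?N"
      by (simp add: power2_eq_square del: of_nat_Suc)
    finally show ?thesis .
  qed
  show ?thesis
  proof (rule ccontr)
    assume "tape.prob {\<omega> \<in> space tape. \<omega> i = \<omega> j} \<noteq> 0"
    then have "0 < tape.prob {\<omega> \<in> space tape. \<omega> i = \<omega> j} / 2"
      by (simp add: zero_less_measure_iff)
    then obtain N where "inverse (real (Suc N)) < tape.prob {\<omega> \<in> space tape. \<omega> i = \<omega> j} / 2"
      using reals_Archimedean by blast
    with le[of N] show False
      by (simp add: inverse_eq_divide)
  qed
qed

text \<open>Independent identically distributed coordinates are exchangeable.\<close>

lemma distr_tape_permute:
  assumes "inj \<pi>"
  shows "distr tape tape (\<lambda>\<omega> i. \<omega> (\<pi> i)) = tape"
  using distr_PiM_reindex[of UNIV "\<lambda>_. uniform01" \<pi> UNIV] assms prob_space_uniform01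
  by (simp add: tape_def restrict_UNIV)

text \<open>
  Permuting the priorities in \<open>S\<close> shows that the \<open>card S\<close> choices of \<open>c\<close> are equally likely, and
  up to ties these events are disjoint.
\<close>

lemma tape_least:
  assumes S: "finite S" "c \<in> S" and ab: "a \<le> b"
  shows "tape.prob {\<omega> \<in> space tape. (a \<le> \<omega> 0 \<and> \<omega> 0 \<le> b) \<and> (\<forall>c'\<in>S. \<omega> (Suc c) \<le> \<omega> (Suc c'))}
    \<le> (b - a) / card S"
proof -
  let ?A = "\<lambda>c. {\<omega> \<in> space tape. (a \<le> \<omega> 0 \<and> \<omega> 0 \<le> b) \<and> (\<forall>c'\<in>S. \<omega> (Suc c) \<le> \<omega> (Suc c'))}"
  let ?T = "\<Union>x\<in>S. \<Union>y\<in>S - {x}. {\<omega> \<in> space tape. \<omega> (Suc x) = \<omega> (Suc y)}"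
  have A: "?A x \<in> tape.events" for x
    using S(1) by measurable
  have T: "?T \<in> tape.events"
    using S(1) by measurable
  have "tape.prob ?T \<le> (\<Sum>x\<in>S. \<Sum>y\<in>S - {x}. tape.prob {\<omega> \<in> space tape. \<omega> (Suc x) = \<omega> (Suc y)})"
    using S(1)
    by (intro order_trans[OF tape.finite_measure_subadditive_finite] sum_mono
        tape.finite_measure_subadditive_finite) auto
  also have "\<dots> = 0"
    by (intro sum.neutral ballI tape_no_ties) auto
  finally have "tape.prob ?T = 0"
    using measure_nonneg[of tape ?T] by linarith
  then have T0: "?T \<in> null_sets tape"
    using T by (simp add: tape.emeasure_eq_measure null_sets_def)
  have sym: "tape.prob (?A x) = tape.prob (?A c)" if "x \<in> S" for x
  proof -
    \<comment> \<open>This swaps two priorities and fixes coordinate 0, so the condition on the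
      radius is untouched.\<close>
    let ?\<pi> = "Transposition.transpose (Suc x) (Suc c)"
    have \<pi>: "(\<forall>c'\<in>S. y \<le> \<omega> (?\<pi> (Suc c'))) \<longleftrightarrow> (\<forall>c'\<in>S. y \<le> \<omega> (Suc c'))" for y :: real and \<omega>
    proof -
      have "(\<lambda>c'. ?\<pi> (Suc c')) ` S = Suc ` S"
        using that S(2) by (auto simp: Transposition.transpose_def image_iff)
      then show ?thesis
        by (metis (no_types, lifting) imageE imageI)
    qed
    have meas: "(\<lambda>\<omega> i. \<omega> (?\<pi> i)) \<in> tape \<rightarrow>\<^sub>M tape"
      unfolding tape_def by (rule measurable_PiM_single') (auto simp: space_PiM)
    have "tape.prob (?A x) = measure (distr tape tape (\<lambda>\<omega> i. \<omega> (?\<pi> i))) (?A x)"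
      by (subst distr_tape_permute) auto
    also have "\<dots> = tape.prob ((\<lambda>\<omega> i. \<omega> (?\<pi> i)) -` ?A x \<inter> space tape)"
      by (rule measure_distr[OF meas A])
    also have "(\<lambda>\<omega> i. \<omega> (?\<pi> i)) -` ?A x \<inter> space tape = ?A c"
      using \<pi> measurable_space[OF meas] by (auto simp: Transposition.transpose_def)
    finally show ?thesis .
  qed
  have "card S * tape.prob (?A c) = (\<Sum>x\<in>S. tape.prob (?A c))"
    by simp
  also have "\<dots> = (\<Sum>x\<in>S. tape.prob (?A x))"
    by (intro sum.cong refl sym[symmetric])
  \<comment> \<open>Discarding the null set of ties makes the events disjoint without changing their
    probabilities.\<close>
  also have "\<dots> = (\<Sum>x\<in>S. tape.prob (?A x - ?T))"
    by (intro sum.cong refl measure_Diff_null_set[symmetric] A T0)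
  also have "\<dots> = tape.prob (\<Union>x\<in>S. ?A x - ?T)"
  proof (rule tape.finite_measure_finite_Union[symmetric])
    show "disjoint_family_on (\<lambda>x. ?A x - ?T) S"
      unfolding disjoint_family_on_def by (auto; metis Diff_iff antisym singletonD)
  qed (use S A T in auto)
  also have "\<dots> \<le> tape.prob {\<omega> \<in> space tape. a \<le> \<omega> 0 \<and> \<omega> 0 \<le> b}"
    by (intro tape.finite_measure_mono) auto
  also have "\<dots> \<le> b - a"
    by (rule tape_interval[OF ab])
  finally have le: "card S * tape.prob (?A c) \<le> b - a" .
  have "0 < real (card S)"
    using S by (auto simp: card_gt_0_iff)
  then show ?thesis
    using le by (subst pos_le_divide_eq) (simp_all only: mult.commute)
qed

text \<open>Sorted by \<open>m\<close>, the \<open>i\<close>-th element has rank at least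
  \<open>i\<close>, as ties only enlarge ranks. The induction removes a maximal element, whose rank
  is \<open>card S\<close>; this raises no other rank.\<close>

lemma sum_inverse_rank_le_harm:
  fixes m :: "'a \<Rightarrow> real"
  assumes "finite S"
  shows "(\<Sum>c\<in>S. 1 / real (card {c'\<in>S. m c' \<le> m c})) \<le> harm (card S)"
  using assms
proof (induction "card S" arbitrary: S)
  case 0
  then show ?case by (simp add: harm_def)
next
  case (Suc k)
  then have "S \<noteq> {}" by auto
  then have "Max (m ` S) \<in> m ` S"
    using Suc.prems by simp
  then obtain x where "x \<in> S" "m x = Max (m ` S)"
    by auto
  then have x: "x \<in> S" "\<And>y. y \<in> S \<Longrightarrow> m y \<le> m x"
    using Suc.prems by auto
  have rank: "1 / real (card {c'\<in>S. m c' \<le> m c}) \<le> 1 / real (card {c'\<in>S - {x}. m c' \<le> m c})"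
    if "c \<in> S - {x}" for c
  proof (intro divide_left_mono)
    show "real (card {c'\<in>S - {x}. m c' \<le> m c}) \<le> real (card {c'\<in>S. m c' \<le> m c})"
      using Suc.prems by (intro of_nat_mono card_mono) auto
    have "c \<in> {c'\<in>S - {x}. m c' \<le> m c}" "c \<in> {c'\<in>S. m c' \<le> m c}"
      using that by auto
    then show "0 < real (card {c'\<in>S. m c' \<le> m c}) * real (card {c'\<in>S - {x}. m c' \<le> m c})"
      using Suc.prems by (auto simp: card_gt_0_iff intro!: mult_pos_pos)
  qed simp
  have card: "card (S - {x}) = k"
    using Suc x by simp
  have "(\<Sum>c\<in>S. 1 / real (card {c'\<in>S. m c' \<le> m c})) =
      1 / real (card {c'\<in>S. m c' \<le> m x}) + (\<Sum>c\<in>S - {x}. 1 / real (card {c'\<in>S. m c' \<le> m c}))"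
    using Suc.prems x(1) by (rule sum.remove)
  also have "{c'\<in>S. m c' \<le> m x} = S"
    using x by auto
  also have "(\<Sum>c\<in>S - {x}. 1 / real (card {c'\<in>S. m c' \<le> m c})) \<le>
      (\<Sum>c\<in>S - {x}. 1 / real (card {c'\<in>S - {x}. m c' \<le> m c}))"
    by (intro sum_mono rank)
  also have "\<dots> \<le> harm k"
    using Suc.hyps(1)[of "S - {x}"] card Suc.prems by simp
  also have "1 / real (card S) + harm k = harm (card S)"
    unfolding Suc.hyps(2)[symmetric] by (simp add: harm_Suc inverse_eq_divide)
  finally show ?case by simp
qed

text \<open>The difference \<open>harm k - ln k\<close> is nonincreasing and equals 1 at
  \<open>k = 1\<close>.\<close>

lemma harm_le: "0 < n \<Longrightarrow> harm n \<le> 1 + ln (real n)"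
proof -
  assume "0 < n"
  then obtain k where n: "n = Suc k"
    by (cases n) auto
  have "harm (Suc k) - ln (real (Suc k)) \<le> harm (Suc 0) - ln (real (Suc 0))"
    using decseqD[OF decseq_harm_diff_ln, of 0 k] by simp
  then show ?thesis
    by (simp add: n harm_def)
qed

section \<open>Measurability and the probability that an edge is cut\<close>

context decomposition
begin

lemma measurable_labels: "(\<lambda>\<omega>. labels \<omega> u) \<in> tape \<rightarrow>\<^sub>M count_space UNIV"
proof -
  let ?f = "\<lambda>c. profile n d \<Delta> c n"
  have "(\<lambda>\<omega>. best ?f (\<Delta> * \<omega> 0 / 4) (\<lambda>c. \<omega> (Suc c)) k u) \<in> borel_measurable tape \<and>
      (\<lambda>\<omega>. label ?f (\<Delta> * \<omega> 0 / 4) (\<lambda>c. \<omega> (Suc c)) k u) \<in> tape \<rightarrow>\<^sub>M count_space UNIV" for k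
  proof (induction k)
    case (Suc k)
    then have IH: "(\<lambda>\<omega>. best ?f (\<Delta> * \<omega> 0 / 4) (\<lambda>c. \<omega> (Suc c)) k u) \<in> borel_measurable tape"
      "(\<lambda>\<omega>. label ?f (\<Delta> * \<omega> 0 / 4) (\<lambda>c. \<omega> (Suc c)) k u) \<in> tape \<rightarrow>\<^sub>M count_space UNIV"
      by auto
    have "{\<omega> \<in> space tape. ?f k u \<le> \<Delta> * \<omega> 0 / 4} \<in> tape.events"
      by (intro borel_measurable_le borel_measurable_divide borel_measurable_times
          measurable_tape_component measurable_const) auto
    moreover have "{\<omega> \<in> space tape. \<omega> (Suc k) < best ?f (\<Delta> * \<omega> 0 / 4) (\<lambda>c. \<omega> (Suc c)) k u} \<in> tape.events"
      by (intro borel_measurable_less measurable_tape_component IH)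
    ultimately have "{\<omega> \<in> space tape. ?f k u \<le> \<Delta> * \<omega> 0 / 4 \<and>
        \<omega> (Suc k) < best ?f (\<Delta> * \<omega> 0 / 4) (\<lambda>c. \<omega> (Suc c)) k u} \<in> tape.events"
      by (intro sets.sets_Collect_conj)
    then show ?case
      unfolding best.simps label.simps
      by (intro conjI measurable_If measurable_tape_component measurable_const IH) auto
  qed simp
  then show ?thesis
    unfolding labels_def by blast
qed

text \<open>The labels of the points below \<open>n\<close> form a list of naturals. Lists range
  over a countable type, unlike functions on the naturals, so measurability of the components makes
  the list measurable into the discrete space, and the partition is a function of the list.\<close>

lemma measurable_partition_of_labels:
  "(\<lambda>\<omega>. partition_of_labels n (labels \<omega>)) \<in> tape \<rightarrow>\<^sub>M count_space UNIV"
proof -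
  have *: "(\<lambda>\<omega>. map (labels \<omega>) us) \<in> tape \<rightarrow>\<^sub>M count_space UNIV" for us
  proof (induction us)
    case (Cons u us)
    have "(\<lambda>\<omega>. (labels \<omega> u, map (labels \<omega>) us)) \<in> tape \<rightarrow>\<^sub>M count_space UNIV \<Otimes>\<^sub>M count_space UNIV"
      by (intro measurable_Pair measurable_labels Cons)
    then have "(\<lambda>\<omega>. (labels \<omega> u, map (labels \<omega>) us)) \<in> tape \<rightarrow>\<^sub>M count_space UNIV"
      by (simp add: pair_measure_countable)
    from measurable_compose[OF this, of "\<lambda>(x, xs). x # xs" "count_space UNIV"] show ?case
      by simp
  qed simp
  have "partition_of_labels n (labels \<omega>) = partition_of_labels n (\<lambda>u. map (labels \<omega>) [0..<n] ! u)" for \<omega>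
    by (rule partition_of_labels_cong) simp
  then show ?thesis
    using measurable_compose[OF *, of "\<lambda>xs. partition_of_labels n (\<lambda>u. xs ! u)" "count_space UNIV" "[0..<n]"]
    by simp
qed

text \<open>For each centre \<open>c\<close>, the event of \<open>labels_separated\<close> confines
  \<open>\<omega> 0\<close> to a window of length \<open>4 * d u v / \<Delta>\<close> and makes
  \<open>c\<close> first in priority among the centres whose \<open>m\<close> is at most
  \<open>m c\<close>. The factor 4 is the inverse of the range of the radius relative to
  \<open>\<Delta>\<close>, and the union bound over \<open>c\<close> yields a harmonic sum.\<close>

lemma prob_separated:
  assumes uv: "u < n" "v < n"
  shows "tape.prob {\<omega> \<in> space tape. separated (partition_of_labels n (labels \<omega>)) u v}
    \<le> 4 * harm n * (d u v / \<Delta>)"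
proof -
  define m where "m c = min (profile n d \<Delta> c n u) (profile n d \<Delta> c n v)" for c
  let ?S = "\<lambda>c. {c'\<in>{..<n}. m c' \<le> m c}"
  let ?a = "\<lambda>c. 4 * m c / \<Delta>" and ?b = "\<lambda>c. 4 * (m c + d u v) / \<Delta>"
  let ?A = "\<lambda>c. {\<omega> \<in> space tape. (?a c \<le> \<omega> 0 \<and> \<omega> 0 \<le> ?b c) \<and> (\<forall>c'\<in>?S c. \<omega> (Suc c) \<le> \<omega> (Suc c'))}"
  have "{\<omega> \<in> space tape. separated (partition_of_labels n (labels \<omega>)) u v} \<subseteq> (\<Union>c\<in>{..<n}. ?A c)"
  proof
    fix \<omega> assume "\<omega> \<in> {\<omega> \<in> space tape. separated (partition_of_labels n (labels \<omega>)) u v}"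
    then have \<omega>: "\<omega> \<in> space tape" "labels \<omega> u \<noteq> labels \<omega> v"
      using uv by (auto simp: separated_partition_of_labels)
    obtain c where "c < n" "m c \<le> \<Delta> * \<omega> 0 / 4" "\<Delta> * \<omega> 0 / 4 \<le> m c + d u v"
      "\<And>c'. c' < n \<Longrightarrow> m c' \<le> m c \<Longrightarrow> \<omega> (Suc c) \<le> \<omega> (Suc c')"
      unfolding m_def by (rule labels_separated[OF \<omega>(1) uv \<omega>(2)]) blast
    then have "\<omega> \<in> ?A c"
      using \<omega>(1) \<Delta>_pos by (auto simp: field_simps)
    then show "\<omega> \<in> (\<Union>c\<in>{..<n}. ?A c)"
      using \<open>c < n\<close> by blast
  qed
  then have "tape.prob {\<omega> \<in> space tape. separated (partition_of_labels n (labels \<omega>)) u v}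
      \<le> tape.prob (\<Union>c\<in>{..<n}. ?A c)"
    by (intro tape.finite_measure_mono) measurable
  also have "\<dots> \<le> (\<Sum>c\<in>{..<n}. tape.prob (?A c))"
    by (intro tape.finite_measure_subadditive_finite) auto
  also have "\<dots> \<le> (\<Sum>c\<in>{..<n}. 4 * (d u v / \<Delta>) * (1 / card (?S c)))"
  proof (intro sum_mono)
    fix c assume "c \<in> {..<n}"
    then have "tape.prob (?A c) \<le> (?b c - ?a c) / card (?S c)"
      using \<Delta>_pos by (intro tape_least) (auto intro!: divide_right_mono)
    also have "?b c - ?a c = 4 * (d u v / \<Delta>)"
      by (simp add: add_divide_distrib distrib_left)
    finally show "tape.prob (?A c) \<le> 4 * (d u v / \<Delta>) * (1 / card (?S c))"
      by simp
  qed
  also have "\<dots> = 4 * (d u v / \<Delta>) * (\<Sum>c\<in>{..<n}. 1 / card (?S c))"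
    by (simp only: sum_distrib_left)
  also have "\<dots> \<le> 4 * (d u v / \<Delta>) * harm n"
    using sum_inverse_rank_le_harm[of "{..<n}" m] \<Delta>_pos by (intro mult_left_mono) auto
  finally show ?thesis
    by (simp only: mult_ac)
qed

end

section \<open>The decomposition theorem\<close>

text \<open>For \<open>n <= 1\<close> the logarithm is 0 and with it the claimed bound, so the cut
  itself has to vanish there.\<close>

lemma weighted_graph_trivial:
  fixes n :: nat
  assumes G: "weighted_graph {..<n} E w" and n: "n \<le> 1"
  shows "E = {}"
proof (rule ccontr)
  assume "E \<noteq> {}"
  then obtain e where "e \<in> E" by blast
  with G have "e \<subseteq> {..<n}" "card e = 2"
    by (auto simp: weighted_graph_def)
  then have "2 \<le> n"
    using card_mono[of "{..<n}" e] by simp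
  with n show False by simp
qed

text \<open>Minimality gives \<open>(scale n - 1)^2 < 24 * n < 25 * n\<close>, and the missing 1 is
  at most \<open>sqrt n\<close>.\<close>

lemma scale_le_sqrt:
  assumes "0 < n"
  shows "real (scale n) \<le> 6 * sqrt (real n)"
proof (rule ccontr)
  assume "\<not> real (scale n) \<le> 6 * sqrt (real n)"
  moreover have r: "1 \<le> sqrt (real n)"
    using assms by simp
  ultimately have s: "5 * sqrt (real n) < real (scale n) - 1"
    by linarith
  then have "0 < scale n"
    using r by (cases "scale n") auto
  then have "(scale n - 1) * (scale n - 1) < 24 * n"
    by (intro scale_least) simp
  then have "real ((scale n - 1) * (scale n - 1)) < real (24 * n)"
    by (simp only: of_nat_less_iff)
  then have "(real (scale n) - 1) * (real (scale n) - 1) < 24 * real n"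
    using \<open>0 < scale n\<close> by (simp add: of_nat_diff)
  moreover have "(5 * sqrt (real n)) * (5 * sqrt (real n)) \<le> (real (scale n) - 1) * (real (scale n) - 1)"
    using s r \<open>0 < scale n\<close> by (intro mult_mono) auto
  moreover have "(5 * sqrt (real n)) * (5 * sqrt (real n)) = 25 * real n"
    by simp
  ultimately show False by linarith
qed

text \<open>The constant is \<open>2 * 6 * 24 = 288\<close>, with 6 from \<open>scale n\<close> and
  24 from the harmonic factor.\<close>

lemma constants_le:
  fixes q :: real
  assumes q: "1 \<le> q" and n: "2 \<le> n"
  shows "2 * real (scale n) powr ((q - 1) / q) * (4 * harm n) powr (1 / q) \<le>
    288 * real n powr ((q - 1) / (2 * q)) * ln (real n) powr ((q + 1) / (2 * q))"
proof -
  let ?e = "(q - 1) / q" and ?L = "ln (real n)"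
  have e: "0 \<le> ?e" "?e \<le> 1"
    using q by (auto simp: field_simps)
  have "real (scale n) powr ?e \<le> (6 * sqrt (real n)) powr ?e"
    using scale_le_sqrt[of n] n e by (intro powr_mono2) auto
  also have "\<dots> = 6 powr ?e * real n powr ((q - 1) / (2 * q))"
    by (simp add: powr_mult powr_powr flip: powr_half_sqrt)
  also have "\<dots> \<le> 6 powr 1 * real n powr ((q - 1) / (2 * q))"
    using e by (intro mult_right_mono powr_mono) auto
  finally have scale: "real (scale n) powr ?e \<le> 6 * real n powr ((q - 1) / (2 * q))"
    by simp
  have "ln 2 \<le> ?L"
    using n by simp
  then have L: "2 / 3 \<le> ?L"
    using ln2_ge_two_thirds by linarith
  \<comment> \<open>From \<open>2 / 3 <= ?L\<close> follows \<open>1 <= 2 * ?L\<close>, hence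
    \<open>1 + ?L <= 3 * ?L\<close>.\<close>
  have "4 * harm n \<le> 12 * ?L"
    using harm_le[of n] n L by simp
  then have "(4 * harm n) powr (1 / q) \<le> (12 * ?L) powr (1 / q)"
    using q by (intro powr_mono2) (auto simp: harm_nonneg)
  also have "\<dots> = 12 powr (1 / q) * ?L powr (1 / q)"
    using L by (simp add: powr_mult)
  also have "\<dots> \<le> 12 powr 1 * (2 * ?L powr ((q + 1) / (2 * q)))"
  proof (intro mult_mono powr_mono)
    show "?L powr (1 / q) \<le> 2 * ?L powr ((q + 1) / (2 * q))"
    \<comment> \<open>The exponents satisfy \<open>1 / q <= (q + 1) / (2 * q) <= 1\<close>. For
      \<open>?L >= 1\<close> the first inequality suffices; otherwise the left side is at most
      \<open>1 <= 2 * ?L\<close>, and the second applies.\<close>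
    proof (cases "1 \<le> ?L")
      case True
      then have "?L powr (1 / q) \<le> ?L powr ((q + 1) / (2 * q))"
        using q by (intro powr_mono) (auto simp: field_simps)
      also have "\<dots> \<le> 2 * ?L powr ((q + 1) / (2 * q))"
        by simp
      finally show ?thesis .
    next
      case False
      then have "?L powr (1 / q) \<le> 1"
        using L q by (intro powr_le1) auto
      also have "1 \<le> 2 * ?L powr 1"
        using L by simp
      also have "\<dots> \<le> 2 * ?L powr ((q + 1) / (2 * q))"
        using False L q by (intro mult_left_mono powr_mono') (auto simp: field_simps)
      finally show ?thesis .
    qed
  qed (use q in auto)
  finally have harm: "(4 * harm n) powr (1 / q) \<le> 24 * ?L powr ((q + 1) / (2 * q))"
    by simp
  have "real (scale n) powr ?e * (4 * harm n) powr (1 / q) \<le>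
      (6 * real n powr ((q - 1) / (2 * q))) * (24 * ?L powr ((q + 1) / (2 * q)))"
    by (intro mult_mono scale harm) auto
  then show ?thesis by simp
qed

lemma time_bound_poly: "time_bound n = poly [:10, 69, 20, 5:] n"
  by (simp add: time_bound_def algebra_simps)

section \<open>Transfer of the estimates to the program\<close>

context decomposition
begin

lemma returned_partition_program:
  "returned_partition program n d \<Delta> \<omega> = partition_of_labels n (labels \<omega>)"
proof -
  obtain t s where "exec n d \<Delta> \<omega> program init_state t s" "\<forall>u<n. nats s 0 u = labels \<omega> u"
    using steps_program[of n d \<Delta> \<omega>] by (auto simp: steps_def labels_def)
  then show ?thesis
    unfolding returned_partition_def by (simp add: final_state_eq cong: partition_of_labels_cong)
qed

lemma expected_lq_norm_cut_program_le:
  assumes q: "1 \<le> q" and G: "weighted_graph {..<n} E w"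
  shows "(\<integral>\<omega>. lq_norm q {..<n} (cut (partition_of_labels n (labels \<omega>)) E w) \<partial>tape)
    \<le> 288 * real n powr ((q - 1) / (2 * q)) * ln (real n) powr ((q + 1) / (2 * q)) *
      ((\<Sum>u<n. \<Sum>v\<in>nbrs E u. w {u, v} powr q * (d u v / \<Delta>)) powr (1 / q)
       + (\<Sum>u<n. (\<Sum>v\<in>nbrs E u. w {u, v} * (d u v / \<Delta>)) powr q) powr (1 / q))"
    (is "_ \<le> _ * ?R")
proof (cases "n \<le> 1")
  case True
  then have "E = {}"
    using weighted_graph_trivial G by blast
  then show ?thesis
    using q by (simp add: lq_norm_def cut_def nbrs_def)
next
  case False
  then have "(\<integral>\<omega>. lq_norm q {..<n} (cut (partition_of_labels n (labels \<omega>)) E w) \<partial>tape)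
      \<le> 2 * real (scale n) powr ((q - 1) / q) * (4 * harm n) powr (1 / q) * ?R"
    using scale_pos \<Delta>_pos
    by (intro prob_space.expected_lq_norm_cut_le[OF prob_space_tape] measurable_partition_of_labels q G prob_separated
        card_short_separated) (auto simp: harm_nonneg)
  also have "\<dots> \<le> 288 * real n powr ((q - 1) / (2 * q)) * ln (real n) powr ((q + 1) / (2 * q)) * ?R"
    using False by (intro mult_right_mono constants_le q add_nonneg_nonneg) auto
  finally show ?thesis .
qed

end

theorem theorem4p1:
  shows "\<exists>(C :: real) (prog :: com). polynomial_time prog \<and>
    (\<forall>(n :: nat) (d :: nat \<Rightarrow> nat \<Rightarrow> real) (\<Delta> :: real).
      Metric_space {..<n} d \<longrightarrow> \<Delta> > 0 \<longrightarrow>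
      returned_partition prog n d \<Delta> \<in> tape \<rightarrow>\<^sub>M count_space UNIV \<and>
      (\<forall>\<omega>\<in>space tape. partition_on {..<n} (returned_partition prog n d \<Delta> \<omega>) \<and>
        (\<forall>P\<in>returned_partition prog n d \<Delta> \<omega>. diam d P \<le> \<Delta>)) \<and>
      (\<forall>(q :: real) (E :: nat set set) (w :: nat set \<Rightarrow> real).
        q \<ge> 1 \<longrightarrow> weighted_graph {..<n} E w \<longrightarrow>
        (\<integral>\<omega>. lq_norm q {..<n} (cut (returned_partition prog n d \<Delta> \<omega>) E w) \<partial>tape)
          \<le> C * real n powr ((q - 1) / (2 * q)) * ln (real n) powr ((q + 1) / (2 * q)) *
            ((\<Sum>u<n. \<Sum>v\<in>nbrs E u. w {u, v} powr q * (d u v / \<Delta>)) powr (1 / q)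
             + (\<Sum>u<n. (\<Sum>v\<in>nbrs E u. w {u, v} * (d u v / \<Delta>)) powr q) powr (1 / q))))"
proof (intro exI[of _ 288] exI[of _ program] conjI allI impI)
  show "polynomial_time program"
    unfolding polynomial_time_def
  proof (intro exI[of _ "[:10, 69, 20, 5:]"] allI impI ballI)
    fix n d \<Delta> \<omega>
    show "\<exists>t s. exec n d \<Delta> \<omega> program init_state t s \<and> t \<le> poly [:10, 69, 20, 5:] n"
      using steps_program[of n d \<Delta> \<omega>] unfolding steps_def time_bound_poly by blast
  qed
next
  fix n :: nat and d and \<Delta> :: real
  assume "Metric_space {..<n} d" "\<Delta> > 0"
  then interpret decomposition n d \<Delta>
    by (simp add: decomposition_def decomposition_axioms_def)
  have eq: "returned_partition program n d \<Delta> = (\<lambda>\<omega>. partition_of_labels n (labels \<omega>))"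
    by (rule ext) (rule returned_partition_program)
  show "returned_partition program n d \<Delta> \<in> tape \<rightarrow>\<^sub>M count_space UNIV"
    unfolding eq by (rule measurable_partition_of_labels)
  show "\<forall>\<omega>\<in>space tape. partition_on {..<n} (returned_partition program n d \<Delta> \<omega>) \<and>
      (\<forall>P\<in>returned_partition program n d \<Delta> \<omega>. diam d P \<le> \<Delta>)"
    unfolding eq using partition_on_partition_of_labels diam_labels by blast
  fix q :: real and E :: "nat set set" and w :: "nat set \<Rightarrow> real"
  assume "q \<ge> 1" "weighted_graph {..<n} E w"
  then show "(\<integral>\<omega>. lq_norm q {..<n} (cut (returned_partition program n d \<Delta> \<omega>) E w) \<partial>tape)
      \<le> 288 * real n powr ((q - 1) / (2 * q)) * ln (real n) powr ((q + 1) / (2 * q)) *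
        ((\<Sum>u<n. \<Sum>v\<in>nbrs E u. w {u, v} powr q * (d u v / \<Delta>)) powr (1 / q)
         + (\<Sum>u<n. (\<Sum>v\<in>nbrs E u. w {u, v} * (d u v / \<Delta>)) powr q) powr (1 / q))"
    unfolding eq by (rule expected_lq_norm_cut_program_le)
qed

end
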